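(* Let $\{\Phi_n\}_{n=1}^\infty$, $\Phi_n=\{\phi_{n,j}\}_{j=1}^{N_n}$, be a self-similar MIFS on a compact set $X\subset\mathbb{R}^d$, where $\phi_{n,j}(x)=r_{n,j}O_{n,j}(x+\alpha_{n,j})$ with $r_{n,j}\in(0,1)$, $O_{n,j}$ orthogonal matrices and $\alpha_{n,j}\in\mathbb{R}^d$. Assume that the MIFS satisfies the Moran-type open set condition (MOSC) and that $r_0:=\inf\{r_{n,j}:1\le j\le N_n,\ n\ge1\}>0$. Let $s\ge0$. (i) If $0<\liminf\limits_{n\to\infty}\prod_{i=1}^n\sum_{j=1}^{N_i}r_{i,j}^s<+\infty$, then $0<\mathcal{H}^s(K_1)<+\infty$, and so $\dim_{\rm H}(K_1)=s$. (ii) If $\liminf\limits_{n\to\infty}\prod_{i=1}^n\sum_{j=1}^{N_i}r_{i,j}^s=+\infty$, then $\mathcal{H}^s(K_1)=+\infty$, and so $\dim_{\rm H}(K_1)\ge s$. (iii) If $\liminf\limits_{n\to\infty}\prod_{i=1}^n\sum_{j=1}^{N_i}r_{i,j}^s=0$, then $\mathcal{H}^s(K_1)=0$, and so $\dim_{\rm H}(K_1)\le s$.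
   Context: Self-similar MIFS. $X\subset\mathbb{R}^d$ is a nonempty compact set; for each $n\ge1$, $\Phi_n=\{\phi_{n,j}\}_{j=1}^{N_n}$ with $2\le N_n<+\infty$ consists of contracting similarities $\phi_{n,j}(x)=r_{n,j}O_{n,j}(x+\alpha_{n,j})$ with $\phi_{n,j}(X)\subseteq X$; and there are constants $0<c_{1,n}\le c_{2,n}<1$ with $c_{1,n}\le r_{n,j}\le c_{2,n}$ for all $1\le j\le N_n$ and $\lim_{n\to\infty}\prod_{j=1}^n c_{2,j}=0$. The metric is the Euclidean one. Attractors. For each $n\ge1$, $K_n=\{\lim_{k\to\infty}\phi_{n,j_n}\circ\cdots\circ\phi_{n+k,j_{n+k}}(a): 1\le j_{n+k}\le N_{n+k},\ k\ge0\}$, a compact set independent of $a\in X$; $\{K_n\}$ is the unique sequence of nonempty compact subsets of $X$ with $K_n=\bigcup_{j=1}^{N_n}\phi_{n,j}(K_{n+1})$ for all $n\ge1$. MOSC. There is a sequence of open sets $V_n\subset X$ such that for all $n\ge1$: $\phi_{n,j}(V_{n+1})\subseteq V_n$ for $1\le j\le N_n$, and $\phi_{n,i}(V_{n+1})\cap\phi_{n,j}(V_{n+1})=\emptyset$ for $1\le i\ne j\le N_n$; and moreover $\inf_{n\ge1}\mathcal{L}^d(V_n)>0$, where $\mathcal{L}^d$ is $d$-dimensional Lebesgue measure. $\mathcal{H}^s$ is $s$-dimensional Hausdorff measure and $\dim_{\rm H}$ is Hausdorff dimension. *)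

theory Defs
  imports "HOL-Analysis.Analysis"
begin

text \<open>The value \<open>|U|^s\<close> with the conventions \<open>0^0 = 1\<close> for nonempty \<open>U\<close> and \<open>|{}|^s = 0\<close>, so that
  the case \<open>s = 0\<close> yields counting measure; note that \<open>0 powr 0 = 0\<close> in the library.\<close>

definition diam_powr :: "real \<Rightarrow> 'a::metric_space set \<Rightarrow> ennreal" where
  "diam_powr s U = (if U = {} then 0 else if s = 0 then 1 else ennreal (diameter U powr s))"

text \<open>Covers may contain empty sets, so finite covers are included. Boundedness is required
  explicitly because \<open>diameter\<close> is unspecified on unbounded sets.\<close>

definition hausdorff_premeasure :: "real \<Rightarrow> real \<Rightarrow> 'a::metric_space set \<Rightarrow> ennreal" where
  "hausdorff_premeasure \<delta> s A =
     (INF U \<in> {U :: nat \<Rightarrow> 'a set. A \<subseteq> (\<Union>i. U i) \<and> (\<forall>i. bounded (U i) \<and> diameter (U i) \<le> \<delta>)}.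
        \<Sum>i. diam_powr s (U i))"

definition hausdorff_measure :: "real \<Rightarrow> 'a::metric_space set \<Rightarrow> ennreal" where
  "hausdorff_measure s A = (SUP \<delta> \<in> {0<..}. hausdorff_premeasure \<delta> s A)"

definition hausdorff_dim :: "'a::metric_space set \<Rightarrow> ennreal" where
  "hausdorff_dim A = (INF s \<in> {s. 0 \<le> s \<and> hausdorff_measure s A = 0}. ennreal s)"

text \<open>Throughout, only the indices \<open>n \<ge> 1\<close> and \<open>1 \<le> j \<le> N n\<close> are meaningful.\<close>

definition sim_maps ::
    "(nat \<Rightarrow> nat \<Rightarrow> real) \<Rightarrow> (nat \<Rightarrow> nat \<Rightarrow> real^'d^'d) \<Rightarrow> (nat \<Rightarrow> nat \<Rightarrow> real^'d)
      \<Rightarrow> nat \<Rightarrow> nat \<Rightarrow> real^'d \<Rightarrow> real^'d" where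
  "sim_maps r Q \<alpha> n j x = r n j *\<^sub>R (Q n j *v (x + \<alpha> n j))"

definition self_similar_MIFS ::
    "(real^'d) set \<Rightarrow> (nat \<Rightarrow> nat) \<Rightarrow> (nat \<Rightarrow> nat \<Rightarrow> real) \<Rightarrow> (nat \<Rightarrow> nat \<Rightarrow> real^'d^'d)
      \<Rightarrow> (nat \<Rightarrow> nat \<Rightarrow> real^'d) \<Rightarrow> bool" where
  "self_similar_MIFS X N r Q \<alpha> \<longleftrightarrow>
     X \<noteq> {} \<and> compact X \<and>
     (\<forall>n\<ge>1. 2 \<le> N n) \<and>
     (\<forall>n\<ge>1. \<forall>j\<in>{1..N n}. 0 < r n j \<and> r n j < 1 \<and> orthogonal_matrix (Q n j) \<and>
        sim_maps r Q \<alpha> n j ` X \<subseteq> X) \<and>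
     (\<exists>c1 c2 :: nat \<Rightarrow> real.
        (\<forall>n\<ge>1. 0 < c1 n \<and> c1 n \<le> c2 n \<and> c2 n < 1 \<and>
           (\<forall>j\<in>{1..N n}. c1 n \<le> r n j \<and> r n j \<le> c2 n)) \<and>
        (\<lambda>n. \<Prod>j=1..n. c2 j) \<longlonglongrightarrow> 0)"

text \<open>\<open>comp_maps \<phi> w n k\<close> is \<open>\<phi> n (w n) \<circ> \<dots> \<circ> \<phi> (n + k) (w (n + k))\<close>.\<close>

primrec comp_maps :: "(nat \<Rightarrow> nat \<Rightarrow> 'a \<Rightarrow> 'a) \<Rightarrow> (nat \<Rightarrow> nat) \<Rightarrow> nat \<Rightarrow> nat \<Rightarrow> 'a \<Rightarrow> 'a" where
  "comp_maps \<phi> w n 0 = \<phi> n (w n)"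
| "comp_maps \<phi> w n (Suc k) = comp_maps \<phi> w n k \<circ> \<phi> (n + Suc k) (w (n + Suc k))"

text \<open>The set \<open>K\<^sub>n\<close>, with the base point \<open>a \<in> X\<close> as an explicit parameter.\<close>

definition attractor ::
    "(nat \<Rightarrow> nat) \<Rightarrow> (nat \<Rightarrow> nat \<Rightarrow> 'a \<Rightarrow> 'a) \<Rightarrow> 'a \<Rightarrow> nat \<Rightarrow> 'a::metric_space set" where
  "attractor N \<phi> a n =
     {x. \<exists>w. (\<forall>k. w (n + k) \<in> {1..N (n + k)}) \<and> (\<lambda>k. comp_maps \<phi> w n k a) \<longlonglongrightarrow> x}"

definition MOSC ::
    "(real^'d) set \<Rightarrow> (nat \<Rightarrow> nat) \<Rightarrow> (nat \<Rightarrow> nat \<Rightarrow> real^'d \<Rightarrow> real^'d) \<Rightarrow> bool" where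
  "MOSC X N \<phi> \<longleftrightarrow>
     (\<exists>V :: nat \<Rightarrow> (real^'d) set.
        (\<forall>n\<ge>1. open (V n) \<and> V n \<subseteq> X) \<and>
        (\<forall>n\<ge>1. \<forall>j\<in>{1..N n}. \<phi> n j ` V (Suc n) \<subseteq> V n) \<and>
        (\<forall>n\<ge>1. \<forall>i\<in>{1..N n}. \<forall>j\<in>{1..N n}. i \<noteq> j \<longrightarrow>
           \<phi> n i ` V (Suc n) \<inter> \<phi> n j ` V (Suc n) = {}) \<and>
        0 < (INF n\<in>{1..}. emeasure lebesgue (V n)))"

end

theory Submission
  imports Defs
begin

text \<open>Write \<open>P n\<close> for the product of the first \<open>n\<close> level sums, which is the sum of the \<open>s\<close>-th powers
  of the ratios of all cylinders of level \<open>n\<close>. Covering the attractor by these cylinders bounds its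
  Hausdorff measure by a constant times \<open>liminf P\<close>.

  Conversely, a countable cover may be enlarged to balls of nearly the same diameters; by
  compactness all cylinders of some level \<open>n\<close> then lie in finitely many of these balls. Give a cylinder
  of ratio \<open>t\<close> at level \<open>n\<close> the mass \<open>t powr s / P n\<close>, so that the total mass is 1 and a
  cylinder of ratio \<open>t\<close> at any level \<open>q \<le> n\<close> has mass \<open>t powr s / P q\<close>. The open sets
  belonging to the cylinders of ratio comparable to \<open>\<rho>\<close> that meet a ball of radius \<open>\<rho>\<close> are
  disjoint, lie in a ball of comparable radius, and each has volume at least a constant times
  \<open>\<rho> ^ d\<close>. Hence the ball has mass at most a constant times \<open>\<rho> powr s / L\<close>, provided \<open>P q\<close> is at
  least \<open>L\<close> at the levels involved, and the sum of \<open>\<rho> powr s\<close> over the cover is at least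
  a constant times \<open>L\<close>.\<close>

section \<open>Hausdorff measure\<close>

lemma hausdorff_premeasure_le_measure:
  "0 < \<delta> \<Longrightarrow> hausdorff_premeasure \<delta> s A \<le> hausdorff_measure s A"
  unfolding hausdorff_measure_def by (intro SUP_upper) auto

lemma hausdorff_premeasure_antimono:
  fixes A :: "'a::metric_space set"
  assumes "\<delta> \<le> \<epsilon>"
  shows "hausdorff_premeasure \<epsilon> s A \<le> hausdorff_premeasure \<delta> s A"
  unfolding hausdorff_premeasure_def
proof (rule INF_superset_mono)
  show "{U :: nat \<Rightarrow> 'a set. A \<subseteq> (\<Union>i. U i) \<and> (\<forall>i. bounded (U i) \<and> diameter (U i) \<le> \<delta>)}
    \<subseteq> {U. A \<subseteq> (\<Union>i. U i) \<and> (\<forall>i. bounded (U i) \<and> diameter (U i) \<le> \<epsilon>)}"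
    by (rule Collect_mono) (meson assms order_trans)
qed (rule order_refl)

lemma hausdorff_measure_leI:
  assumes "\<And>\<delta>. 0 < \<delta> \<Longrightarrow> hausdorff_premeasure \<delta> s A \<le> b"
  shows "hausdorff_measure s A \<le> b"
  unfolding hausdorff_measure_def using assms by (intro SUP_least) auto

lemma hausdorff_premeasure_le_sum:
  fixes A :: "'a::metric_space set"
  assumes J: "finite J" and cover: "A \<subseteq> (\<Union>j\<in>J. U j)" and "0 \<le> \<delta>"
    and U: "\<And>j. j \<in> J \<Longrightarrow> bounded (U j) \<and> diameter (U j) \<le> \<delta>"
  shows "hausdorff_premeasure \<delta> s A \<le> (\<Sum>j\<in>J. diam_powr s (U j))"
proof -
  obtain e :: "nat \<Rightarrow> 'b" where e: "bij_betw e {..<card J} J"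
    using ex_bij_betw_nat_finite[OF J] unfolding atLeast0LessThan by blast
  \<comment> \<open>Padding with empty sets is free: \<open>diam_powr s {} = 0\<close> even for
    \<open>s = 0\<close>.\<close>
  define W where "W i = (if i < card J then U (e i) else {})" for i
  have im: "e ` {..<card J} = J"
    using e by (simp add: bij_betw_def)
  have "A \<subseteq> (\<Union>i. W i)"
  proof
    fix x assume "x \<in> A"
    then obtain j where j: "j \<in> J" "x \<in> U j"
      using cover by blast
    then have "j \<in> e ` {..<card J}"
      by (simp only: im)
    then obtain i where "i < card J" "j = e i"
      by auto
    with j have "i < card J" "x \<in> U (e i)" by simp_all
    then have "x \<in> W i" by (simp add: W_def)
    then show "x \<in> (\<Union>i. W i)" by blast
  qed
  moreover have "bounded (W i) \<and> diameter (W i) \<le> \<delta>" for i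
  proof (cases "i < card J")
    case True
    then show ?thesis using U im by (auto simp: W_def)
  qed (use \<open>0 \<le> \<delta>\<close> in \<open>simp add: W_def\<close>)
  ultimately have "hausdorff_premeasure \<delta> s A \<le> (\<Sum>i. diam_powr s (W i))"
    unfolding hausdorff_premeasure_def by (intro INF_lower) auto
  also have "\<dots> = (\<Sum>i<card J. diam_powr s (W i))"
    by (rule suminf_finite) (auto simp: W_def diam_powr_def)
  also have "\<dots> = (\<Sum>i<card J. diam_powr s (U (e i)))"
    by (simp add: W_def)
  also have "\<dots> = (\<Sum>j\<in>J. diam_powr s (U j))"
    by (rule sum.reindex_bij_betw[OF e])
  finally show ?thesis .
qed

lemma diam_powr_le:
  fixes U :: "'a::metric_space set"
  assumes "bounded U" "diameter U \<le> d" "0 \<le> s" "0 < d"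
  shows "diam_powr s U \<le> ennreal (d powr s)"
proof -
  have "diameter U powr s \<le> d powr s"
    using assms diameter_ge_0 by (intro powr_mono2) auto
  then show ?thesis
    using assms by (auto simp: diam_powr_def ennreal_leI)
qed

text \<open>Used to replace a covering set by an open ball centred at one of its points. The radius
  must exceed the diameter strictly, and so be positive for one-point sets, while the cost grows by
  at most \<open>e\<close>.\<close>

lemma diam_powr_enlarge:
  fixes U :: "'a::metric_space set"
  assumes "bounded U" "U \<noteq> {}" "diameter U \<le> \<delta>" "0 < \<delta>" "0 < e" "0 \<le> s"
  shows "\<exists>\<rho>. diameter U < \<rho> \<and> \<rho> < 2 * \<delta> \<and> ennreal (\<rho> powr s) \<le> diam_powr s U + ennreal e"
proof (cases "s = 0")
  case True
  \<comment> \<open>Every positive \<open>\<rho>\<close> has \<open>\<rho> powr 0 = 1\<close>, so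
    any radius strictly between \<open>\<delta>\<close> and \<open>2 * \<delta>\<close>
    works.\<close>
  then show ?thesis
    using assms by (intro exI[of _ "3 / 2 * \<delta>"]) (auto simp: diam_powr_def)
next
  case False
  let ?d = "diameter U"
  have d: "0 \<le> ?d" using diameter_ge_0 assms by blast
  \<comment> \<open>The diameter may be 0; right continuity of the power at that point relies on
    \<open>s > 0\<close>.\<close>
  have "((\<lambda>x. x powr s) \<longlongrightarrow> ?d powr s) (at_right ?d)"
    using False assms d
    by (intro tendsto_powr' tendsto_intros disjI2 conjI eventually_mono[OF eventually_at_right_less]) auto
  then have "\<forall>\<^sub>F x in at_right ?d. x powr s < ?d powr s + e"
    using \<open>0 < e\<close> by (intro order_tendstoD(2)) auto
  moreover have "\<forall>\<^sub>F x in at_right ?d. x \<in> {?d<..<2 * \<delta>}"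
    using assms by (intro eventually_at_right_real) auto
  ultimately have "\<forall>\<^sub>F x in at_right ?d. x powr s < ?d powr s + e \<and> x \<in> {?d<..<2 * \<delta>}"
    by eventually_elim auto
  then obtain \<rho> where \<rho>: "\<rho> powr s < ?d powr s + e" "\<rho> \<in> {?d<..<2 * \<delta>}"
    using eventually_happens' trivial_limit_at_right_real by blast
  have "ennreal (\<rho> powr s) \<le> ennreal (?d powr s + e)"
    using \<rho>(1) by (intro ennreal_leI) simp
  also have "\<dots> = diam_powr s U + ennreal e"
    using False assms by (simp add: diam_powr_def)
  finally show ?thesis using \<rho>(2) by auto
qed

section \<open>Dependence on the exponent\<close>

lemma diam_powr_change_exponent:
  fixes U :: "'a::metric_space set"
  assumes "bounded U" "diameter U \<le> \<delta>" "0 < \<delta>" "0 \<le> t" "t < u"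
  shows "diam_powr u U \<le> ennreal (\<delta> powr (u - t)) * diam_powr t U"
proof (cases "U = {} \<or> diameter U = 0")
  \<comment> \<open>Diameter 0 is split off because for \<open>t = 0\<close> a nonempty
    \<open>U\<close> has value 1 by convention; the left side vanishes since
    \<open>u > 0\<close>.\<close>
  case True
  then show ?thesis
    using assms by (auto simp: diam_powr_def)
next
  case False
  then have d: "0 < diameter U"
    using diameter_ge_0[OF assms(1)] by linarith
  have "diameter U powr u = diameter U powr (u - t) * diameter U powr t"
    by (simp add: powr_add[symmetric])
  also have "\<dots> \<le> \<delta> powr (u - t) * diameter U powr t"
    using assms d by (intro mult_right_mono powr_mono2) auto
  finally have "ennreal (diameter U powr u) \<le> ennreal (\<delta> powr (u - t)) * ennreal (diameter U powr t)"
    by (simp add: ennreal_mult[symmetric] ennreal_leI)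
  then show ?thesis
    using False assms d by (auto simp: diam_powr_def)
qed

lemma hausdorff_premeasure_change_exponent:
  fixes A :: "'a::metric_space set"
  assumes "0 < \<delta>" "0 \<le> t" "t < u"
  shows "hausdorff_premeasure \<delta> u A \<le> ennreal (\<delta> powr (u - t)) * hausdorff_premeasure \<delta> t A"
proof -
  let ?c = "ennreal (\<delta> powr (u - t))"
  let ?\<U> = "{U :: nat \<Rightarrow> 'a set. A \<subseteq> (\<Union>i. U i) \<and> (\<forall>i. bounded (U i) \<and> diameter (U i) \<le> \<delta>)}"
  have c: "0 < ?c" "?c < top"
    using assms by auto
  \<comment> \<open>Dividing by the positive finite constant isolates the infimum over covers on the
    right.\<close>
  have "hausdorff_premeasure \<delta> u A / ?c \<le> (\<Sum>i. diam_powr t (U i))" if U: "U \<in> ?\<U>" for U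
  proof -
    have "hausdorff_premeasure \<delta> u A \<le> (\<Sum>i. diam_powr u (U i))"
      unfolding hausdorff_premeasure_def using U by (intro INF_lower)
    also have "\<dots> \<le> (\<Sum>i. ?c * diam_powr t (U i))"
      using U assms by (intro suminf_le diam_powr_change_exponent) auto
    also have "\<dots> = ?c * (\<Sum>i. diam_powr t (U i))"
      by simp
    finally have "hausdorff_premeasure \<delta> u A / ?c \<le> ?c * (\<Sum>i. diam_powr t (U i)) / ?c"
      by (rule divide_right_mono_ennreal)
    also have "\<dots> = (\<Sum>i. diam_powr t (U i))"
      unfolding mult.commute[of ?c] using c by (intro ennreal_mult_divide_eq) auto
    finally show ?thesis .
  qed
  then have "hausdorff_premeasure \<delta> u A / ?c \<le> hausdorff_premeasure \<delta> t A"
    unfolding hausdorff_premeasure_def[of \<delta> t] by (intro INF_greatest) auto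
  then have "hausdorff_premeasure \<delta> u A / ?c * ?c \<le> hausdorff_premeasure \<delta> t A * ?c"
    by (rule mult_right_mono) simp
  moreover have "hausdorff_premeasure \<delta> u A / ?c * ?c = hausdorff_premeasure \<delta> u A"
    unfolding ennreal_divide_times using c by (subst ennreal_divide_self) auto
  ultimately show ?thesis
    by (simp only: mult.commute)
qed

text \<open>For \<epsilon> \<le> \<delta> the premeasure at \<open>\<delta>\<close> and
  \<open>u\<close> is at most \<open>\<epsilon> powr (u - t)\<close> times the finite measure at
  \<open>t\<close>; let \<epsilon> tend to 0.\<close>

lemma hausdorff_measure_zero_of_finite:
  fixes A :: "'a::metric_space set"
  assumes fin: "hausdorff_measure t A < \<infinity>" and "0 \<le> t" "t < u"
  shows "hausdorff_measure u A = 0"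
proof -
  obtain h where h: "hausdorff_measure t A = ennreal h" "0 \<le> h"
    using fin by (cases "hausdorff_measure t A") auto
  have "hausdorff_premeasure \<delta> u A \<le> 0" if "0 < \<delta>" for \<delta>
  proof -
    have bd: "hausdorff_premeasure \<delta> u A \<le> ennreal (\<epsilon> powr (u - t) * h)" if "0 < \<epsilon>" "\<epsilon> \<le> \<delta>" for \<epsilon>
    proof -
      have "hausdorff_premeasure \<delta> u A \<le> hausdorff_premeasure \<epsilon> u A"
        using that by (intro hausdorff_premeasure_antimono)
      also have "\<dots> \<le> ennreal (\<epsilon> powr (u - t)) * hausdorff_premeasure \<epsilon> t A"
        using that assms by (intro hausdorff_premeasure_change_exponent) auto
      also have "\<dots> \<le> ennreal (\<epsilon> powr (u - t)) * ennreal h"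
        using that h hausdorff_premeasure_le_measure[of \<epsilon> t A] by (intro mult_left_mono) auto
      finally show ?thesis
        by (simp add: ennreal_mult h)
    qed
    have "((\<lambda>\<epsilon>. \<epsilon> powr (u - t) * h) \<longlongrightarrow> 0 powr (u - t) * h) (at_right 0)"
      using \<open>t < u\<close>
      by (intro tendsto_intros) (auto simp: eventually_at_right_less less_imp_le
          intro: eventually_mono[OF eventually_at_right_less[of 0]])
    then have "((\<lambda>\<epsilon>. ennreal (\<epsilon> powr (u - t) * h)) \<longlongrightarrow> ennreal (0 powr (u - t) * h)) (at_right 0)"
      by (rule tendsto_ennrealI)
    moreover have "\<forall>\<^sub>F \<epsilon> in at_right 0. hausdorff_premeasure \<delta> u A \<le> ennreal (\<epsilon> powr (u - t) * h)"
      unfolding eventually_at_right_field using bd \<open>0 < \<delta>\<close> by (intro exI[of _ \<delta>]) auto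
    ultimately have "hausdorff_premeasure \<delta> u A \<le> ennreal (0 powr (u - t) * h)"
      by (intro tendsto_lowerbound) auto
    then show ?thesis by simp
  qed
  then have "hausdorff_measure u A \<le> 0"
    by (rule hausdorff_measure_leI)
  then show ?thesis by simp
qed

section \<open>Comparison of the dimension with a given exponent\<close>

lemma hausdorff_dim_le:
  assumes "hausdorff_measure s A < \<infinity>" "0 \<le> s"
  shows "hausdorff_dim A \<le> ennreal s"
proof (rule ennreal_le_epsilon)
  fix e :: real assume "0 < e"
  \<comment> \<open>Finiteness at \<open>s\<close> forces measure zero only at larger exponents,
    hence the detour through \<open>s + e\<close>.\<close>
  then have "hausdorff_measure (s + e) A = 0"
    using assms by (intro hausdorff_measure_zero_of_finite[of s]) auto
  then have "hausdorff_dim A \<le> ennreal (s + e)"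
    unfolding hausdorff_dim_def using assms \<open>0 < e\<close> by (intro INF_lower) auto
  then show "hausdorff_dim A \<le> ennreal s + ennreal e"
    using assms \<open>0 < e\<close> by simp
qed

lemma hausdorff_dim_ge:
  assumes "hausdorff_measure s A \<noteq> 0"
  shows "ennreal s \<le> hausdorff_dim A"
  unfolding hausdorff_dim_def
proof (rule INF_greatest)
  fix t assume "t \<in> {t. 0 \<le> t \<and> hausdorff_measure t A = 0}"
  then have t: "0 \<le> t" "hausdorff_measure t A = 0" by auto
  have "s \<le> t"
    using hausdorff_measure_zero_of_finite[of t A s] t assms by force
  then show "ennreal s \<le> ennreal t" by (rule ennreal_leI)
qed

section \<open>Similarities\<close>

text \<open>Surjectivity is included so that balls map onto balls and open sets to open sets, with
  no appeal to linear structure.\<close>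

definition similarity :: "real \<Rightarrow> ('a::metric_space \<Rightarrow> 'a) \<Rightarrow> bool" where
  "similarity t g \<longleftrightarrow> 0 < t \<and> surj g \<and> (\<forall>x y. dist (g x) (g y) = t * dist x y)"

lemma similarity_id: "similarity 1 id"
  by (simp add: similarity_def)

lemma similarity_comp:
  assumes "similarity t g" "similarity u h"
  shows "similarity (t * u) (g \<circ> h)"
  using assms comp_surj[of h g] unfolding similarity_def by auto

lemma similarity_inj: "similarity t g \<Longrightarrow> inj g"
  unfolding similarity_def inj_def by (metis dist_eq_0_iff mult_eq_0_iff order_less_irrefl)

lemma similarity_continuous: "similarity t g \<Longrightarrow> continuous_on S g"
proof (rule lipschitz_on_continuous_on)
  show "similarity t g \<Longrightarrow> t-lipschitz_on S g"
    by (auto simp: lipschitz_on_def similarity_def)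
qed

lemma similarity_image_ball:
  assumes "similarity t g"
  shows "g ` ball x e = ball (g x) (t * e)"
proof
  show "g ` ball x e \<subseteq> ball (g x) (t * e)"
    using assms by (auto simp: similarity_def)
  show "ball (g x) (t * e) \<subseteq> g ` ball x e"
  proof
    fix y assume y: "y \<in> ball (g x) (t * e)"
    obtain z where "y = g z" using assms unfolding similarity_def surj_def by blast
    with y assms show "y \<in> g ` ball x e" by (auto simp: similarity_def)
  qed
qed

lemma similarity_image_open:
  assumes g: "similarity t g" and V: "open V"
  shows "open (g ` V)"
  unfolding open_contains_ball
proof
  fix y assume "y \<in> g ` V"
  then obtain x where x: "x \<in> V" "y = g x" by auto
  then obtain e where e: "0 < e" "ball x e \<subseteq> V" using V openE by blast
  have "ball y (t * e) \<subseteq> g ` V"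
    using similarity_image_ball[OF g, of x e] e x by auto
  then show "\<exists>\<epsilon>>0. ball y \<epsilon> \<subseteq> g ` V"
    using e g by (intro exI[of _ "t * e"]) (auto simp: similarity_def)
qed

lemma similarity_diameter_le:
  assumes g: "similarity t g" and A: "bounded A"
  shows "bounded (g ` A) \<and> diameter (g ` A) \<le> t * diameter A"
proof -
  have t: "0 < t" using g by (simp add: similarity_def)
  have le: "dist u v \<le> t * diameter A" if "u \<in> g ` A" "v \<in> g ` A" for u v
    using that g t diameter_bounded_bound[OF A] by (auto simp: similarity_def)
  have "bounded (g ` A)"
    using le unfolding bounded_any_center bounded_def by blast
  moreover have "diameter (g ` A) \<le> t * diameter A"
    using le t diameter_ge_0[OF A] unfolding diameter_def[of "g ` A"]
    by (auto intro!: cSUP_least)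
  ultimately show ?thesis by blast
qed

text \<open>Exhausting the open set by disjoint balls (Vitali) avoids determinants: a similarity maps
  balls to balls.\<close>

lemma similarity_emeasure_open_ge:
  fixes V :: "'a::euclidean_space set"
  assumes g: "similarity t g" and V: "open V"
  shows "ennreal (t ^ DIM('a)) * emeasure lborel V \<le> emeasure lborel (g ` V)"
proof -
  have t: "0 < t" using g by (simp add: similarity_def)
  define I where "I = {p :: 'a \<times> real. 0 < snd p \<and> ball (fst p) (snd p) \<subseteq> V}"
  have cov: "\<exists>p. p \<in> I \<and> x \<in> ball (fst p) (snd p) \<and> snd p < d" if "x \<in> V" "0 < d" for x d
  proof -
    obtain e where e: "0 < e" "ball x e \<subseteq> V" using openE[OF V \<open>x \<in> V\<close>] .
    have "ball x (min e (d/2)) \<subseteq> V" using e(2) subset_ball[of "min e (d/2)" e x] by simp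
    then have "(x, min e (d/2)) \<in> I" "x \<in> ball x (min e (d/2))" "min e (d/2) < d"
      using e that by (auto simp: I_def min_def)
    then show ?thesis by (intro exI[of _ "(x, min e (d/2))"] conjI) simp_all
  qed
  obtain C where C: "countable C" "C \<subseteq> I"
    and disj: "pairwise (\<lambda>p q. disjnt (ball (fst p) (snd p)) (ball (fst q) (snd q))) C"
    and neg: "negligible (V - (\<Union>p\<in>C. ball (fst p) (snd p)))"
    by (rule Vitali_covering_theorem_balls[of V I fst snd, OF cov])
  have pos: "0 \<le> snd p" if "p \<in> C" for p using that C by (force simp: I_def)
  let ?U = "\<Union>p\<in>C. ball (fst p) (snd p)"
  have U: "?U \<in> sets borel" "?U \<union> (V - ?U) = V"
    using C by (auto intro!: borel_open open_UN simp: I_def)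
  \<comment> \<open>Negligibility refers to the completed measure; since the remainder is Borel, it
    is a null set of \<open>lborel\<close> itself.\<close>
  have "V - ?U \<in> sets borel"
    using V U(1) by (metis borel_open sets.Diff)
  then have "V - ?U \<in> null_sets lborel"
    using neg by (subst null_sets_completion_iff[symmetric]) (auto simp: negligible_iff_null_sets)
  then have "emeasure lborel V = emeasure lborel ?U"
    using emeasure_Un_null_set[of ?U lborel "V - ?U"] U by (simp only: sets_lborel)
  also have "\<dots> = (\<integral>\<^sup>+p. emeasure lborel (ball (fst p) (snd p)) \<partial>count_space C)"
    using C disj by (intro emeasure_UN_countable) (auto simp: disjoint_family_on_def pairwise_def disjnt_def)
  finally have "ennreal (t ^ DIM('a)) * emeasure lborel V
      = (\<integral>\<^sup>+p. ennreal (t ^ DIM('a)) * emeasure lborel (ball (fst p) (snd p)) \<partial>count_space C)"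
    by (simp add: nn_integral_cmult)
  \<comment> \<open>The image of each ball is a ball with radius multiplied by \<open>t\<close>, so
    its volume is scaled exactly.\<close>
  also have "\<dots> = (\<integral>\<^sup>+p. emeasure lborel (g ` ball (fst p) (snd p)) \<partial>count_space C)"
    using pos t
    by (intro nn_integral_cong)
       (simp add: similarity_image_ball[OF g] emeasure_ball ennreal_mult[symmetric] power_mult_distrib mult_ac)
  also have "\<dots> = emeasure lborel (\<Union>p\<in>C. g ` ball (fst p) (snd p))"
  proof (rule emeasure_UN_countable[symmetric])
    show "disjoint_family_on (\<lambda>p. g ` ball (fst p) (snd p)) C"
      using disj inj_image_eq_iff similarity_inj[OF g]
      by (auto simp: disjoint_family_on_def pairwise_def disjnt_def image_Int[symmetric] simp del: image_Int)
  qed (use C in \<open>auto simp: similarity_image_ball[OF g]\<close>)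
  also have "\<dots> \<le> emeasure lborel (g ` V)"
    using C similarity_image_open[OF g V] by (intro emeasure_mono) (auto simp: I_def)
  finally show ?thesis .
qed

lemma similarity_measure_open_ge:
  fixes V :: "'a::euclidean_space set"
  assumes g: "similarity t g" and V: "open V" "bounded V"
  shows "t ^ DIM('a) * measure lborel V \<le> measure lborel (g ` V)"
proof -
  have "emeasure lborel V < \<infinity>" "emeasure lborel (g ` V) < \<infinity>"
    using V similarity_diameter_le[OF g] emeasure_bounded_finite by blast+
  then have eq: "emeasure lborel V = ennreal (measure lborel V)"
    "emeasure lborel (g ` V) = ennreal (measure lborel (g ` V))"
    by (simp_all add: emeasure_eq_ennreal_measure)
  have "0 \<le> t ^ DIM('a)" using g by (simp add: similarity_def)
  then show ?thesis
    using similarity_emeasure_open_ge[OF g V(1)] by (simp add: eq ennreal_mult[symmetric])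
qed

section \<open>Moran constructions\<close>

text \<open>The setting for coding the attractor, bounding its measure from above and extracting
  finite subcovers; separation enters in \<open>moran_open_set\<close>.\<close>

locale moran_system =
  fixes X :: "'a::euclidean_space set"
    and N :: "nat \<Rightarrow> nat"
    and \<phi> :: "nat \<Rightarrow> nat \<Rightarrow> 'a \<Rightarrow> 'a"
    and r :: "nat \<Rightarrow> nat \<Rightarrow> real"
    and c :: "nat \<Rightarrow> real"
    and s :: real
  assumes X_nonempty: "X \<noteq> {}"
    and X_compact: "compact X"
    and N_pos: "1 \<le> n \<Longrightarrow> 1 \<le> N n"
    and similarity_map: "\<lbrakk>1 \<le> n; j \<in> {1..N n}\<rbrakk> \<Longrightarrow> similarity (r n j) (\<phi> n j)"
    and map_X: "\<lbrakk>1 \<le> n; j \<in> {1..N n}\<rbrakk> \<Longrightarrow> \<phi> n j ` X \<subseteq> X"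
    and ratio_le: "\<lbrakk>1 \<le> n; j \<in> {1..N n}\<rbrakk> \<Longrightarrow> r n j \<le> c n"
    and c_prod_tendsto: "(\<lambda>n. \<Prod>i=1..n. c i) \<longlonglongrightarrow> 0"
    and s_nonneg: "0 \<le> s"
begin

definition level_sum :: "nat \<Rightarrow> real" where
  "level_sum n = (\<Sum>j=1..N n. r n j powr s)"

abbreviation level_prod :: "nat \<Rightarrow> real" where
  "level_prod n \<equiv> \<Prod>i=1..n. level_sum i"

lemma ratio_pos: "\<lbrakk>1 \<le> n; j \<in> {1..N n}\<rbrakk> \<Longrightarrow> 0 < r n j"
  using similarity_map similarity_def by blast

lemma c_pos: "1 \<le> n \<Longrightarrow> 0 < c n"
  using ratio_pos[of n 1] ratio_le[of n 1] N_pos[of n] by auto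

lemma level_sum_pos: "1 \<le> n \<Longrightarrow> 0 < level_sum n"
  unfolding level_sum_def using N_pos[of n] ratio_pos[of n]
  by (intro sum_pos) (force simp: Suc_le_eq powr_gt_zero)+

lemma c_nonneg: "1 \<le> n \<Longrightarrow> 0 \<le> c n"
  using c_pos[of n] by simp

lemma level_sum_nonneg: "1 \<le> n \<Longrightarrow> 0 \<le> level_sum n"
  using level_sum_pos[of n] by simp

lemma level_prod_pos: "0 < level_prod n"
  by (intro prod_pos) (auto intro: level_sum_pos)

lemma bounded_X: "bounded X"
  using X_compact compact_imp_bounded by blast

subsection \<open>Addresses\<close>

definition address :: "(nat \<Rightarrow> nat) \<Rightarrow> bool" where
  "address w \<longleftrightarrow> (\<forall>n\<ge>1. w n \<in> {1..N n})"

text \<open>Ratios multiply under composition. Index \<open>k\<close> stands for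
  \<open>Suc k\<close> maps, those of levels 1 to \<open>Suc k\<close>.\<close>

lemma comp_maps_similarity:
  assumes "\<And>i. i \<in> {1..Suc k} \<Longrightarrow> w i \<in> {1..N i}"
  shows "similarity (\<Prod>i=1..Suc k. r i (w i)) (comp_maps \<phi> w 1 k)"
  using assms
proof (induction k)
  case 0
  then show ?case by (simp add: similarity_map)
next
  case (Suc k)
  have "similarity ((\<Prod>i=1..Suc k. r i (w i)) * r (Suc (Suc k)) (w (Suc (Suc k))))
     (comp_maps \<phi> w 1 k \<circ> \<phi> (Suc (Suc k)) (w (Suc (Suc k))))"
    using Suc.prems by (intro similarity_comp Suc.IH similarity_map) auto
  then show ?case
    by (simp only: comp_maps.simps plus_1_eq_Suc prod.nat_ivl_Suc' le_add1 mult.commute)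
qed

lemma comp_maps_decseq:
  assumes "address w"
  shows "decseq (\<lambda>k. comp_maps \<phi> w 1 k ` X)"
proof (rule decseq_SucI)
  fix k
  have "\<phi> (Suc (Suc k)) (w (Suc (Suc k))) ` X \<subseteq> X"
    using assms by (intro map_X) (auto simp: address_def)
  then show "comp_maps \<phi> w 1 (Suc k) ` X \<subseteq> comp_maps \<phi> w 1 k ` X"
    by (auto simp: image_comp[symmetric])
qed

lemma comp_maps_in:
  assumes "address w" "k \<le> l" "x \<in> X"
  shows "comp_maps \<phi> w 1 l x \<in> comp_maps \<phi> w 1 k ` X"
  using decseqD[OF comp_maps_decseq[OF assms(1)] assms(2)] assms(3) by blast

lemma comp_maps_cong:
  "(\<And>i. i \<in> {n..n + k} \<Longrightarrow> w i = v i) \<Longrightarrow> comp_maps \<psi> w n k = comp_maps \<psi> v n k"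
  by (induction k) auto

lemma comp_maps_dist_le:
  assumes w: "\<And>i. i \<in> {1..Suc k} \<Longrightarrow> w i \<in> {1..N i}"
    and x: "x \<in> comp_maps \<phi> w 1 k ` X" and y: "y \<in> comp_maps \<phi> w 1 k ` X"
  shows "dist x y \<le> (\<Prod>i=1..Suc k. c i) * diameter X"
proof -
  obtain x' y' where x': "x' \<in> X" "y' \<in> X" "x = comp_maps \<phi> w 1 k x'" "y = comp_maps \<phi> w 1 k y'"
    using x y by auto
  have "dist x y = (\<Prod>i=1..Suc k. r i (w i)) * dist x' y'"
    using comp_maps_similarity[OF w] x' by (simp add: similarity_def)
  also have "\<dots> \<le> (\<Prod>i=1..Suc k. c i) * diameter X"
    using w x' ratio_le ratio_pos
    by (intro mult_mono prod_mono diameter_bounded_bound[OF bounded_X] prod_nonneg)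
       (auto intro: less_imp_le c_nonneg)
  finally show ?thesis .
qed

lemma attractor_alt:
  "x \<in> attractor N \<phi> a 1 \<longleftrightarrow> (\<exists>w. address w \<and> (\<lambda>k. comp_maps \<phi> w 1 k a) \<longlonglongrightarrow> x)"
proof -
  have "(\<forall>k. w (1 + k) \<in> {1..N (1 + k)}) \<longleftrightarrow> address w" for w
    unfolding address_def by (metis le_add1 le_iff_add)
  then show ?thesis by (simp add: attractor_def)
qed

text \<open>From index \<open>k\<close> on, the approximating points lie in the cylinder, which is
  compact and hence closed.\<close>

lemma limit_in_cylinder:
  assumes w: "address w" and a: "a \<in> X" and x: "(\<lambda>k. comp_maps \<phi> w 1 k a) \<longlonglongrightarrow> x"
  shows "x \<in> comp_maps \<phi> w 1 k ` X"
proof -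
  have "similarity (\<Prod>i=1..Suc k. r i (w i)) (comp_maps \<phi> w 1 k)"
    using w by (intro comp_maps_similarity) (auto simp: address_def)
  then have "closed (comp_maps \<phi> w 1 k ` X)"
    using X_compact by (intro compact_imp_closed compact_continuous_image similarity_continuous)
  moreover have "\<forall>\<^sub>F l in sequentially. comp_maps \<phi> w 1 l a \<in> comp_maps \<phi> w 1 k ` X"
    using comp_maps_in[OF w _ a] unfolding eventually_sequentially by blast
  ultimately show ?thesis
    using x by (intro Lim_in_closed_set) auto
qed

lemma shrink: "0 < e \<Longrightarrow> \<forall>\<^sub>F k in sequentially. (\<Prod>i=1..Suc k. c i) * diameter X < e"
proof -
  assume "0 < e"
  have "(\<lambda>k. (\<Prod>i=1..Suc k. c i) * diameter X) \<longlonglongrightarrow> 0 * diameter X"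
    by (intro tendsto_mult tendsto_const LIMSEQ_Suc[OF c_prod_tendsto])
  then show ?thesis
    using \<open>0 < e\<close> by (intro order_tendstoD(2)) auto
qed

text \<open>All points from index \<open>K\<close> on lie in one cylinder, and the diameters of
  these nested cylinders tend to 0.\<close>

lemma address_converges:
  assumes w: "address w" and a: "a \<in> X"
  obtains x where "(\<lambda>k. comp_maps \<phi> w 1 k a) \<longlonglongrightarrow> x"
proof -
  have "Cauchy (\<lambda>k. comp_maps \<phi> w 1 k a)"
  proof (rule metric_CauchyI)
    fix e :: real assume "0 < e"
    then obtain K where K: "(\<Prod>i=1..Suc K. c i) * diameter X < e"
      using shrink eventually_happens' sequentially_bot by blast
    have "dist (comp_maps \<phi> w 1 m a) (comp_maps \<phi> w 1 n a) < e" if "K \<le> m" "K \<le> n" for m n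
    proof -
      have "dist (comp_maps \<phi> w 1 m a) (comp_maps \<phi> w 1 n a) \<le> (\<Prod>i=1..Suc K. c i) * diameter X"
        by (rule comp_maps_dist_le[where w = w])
          (use w that comp_maps_in[OF w _ a] in \<open>auto simp: address_def\<close>)
      with K show ?thesis by simp
    qed
    then show "\<exists>M. \<forall>m\<ge>M. \<forall>n\<ge>M. dist (comp_maps \<phi> w 1 m a) (comp_maps \<phi> w 1 n a) < e"
      by blast
  qed
  then show ?thesis
    using that Cauchy_convergent convergent_def by blast
qed

subsection \<open>The upper bound\<close>

text \<open>The cylinders of level \<open>Suc k\<close> form a finite cover. The bound
  \<open>D\<close> must be positive: for a one-point \<open>X\<close> and \<open>s = 0\<close>,
  using the diameter itself would give \<open>0 powr 0 = 0\<close>.\<close>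

lemma hausdorff_premeasure_attractor_le:
  assumes a: "a \<in> X" and small: "(\<Prod>i=1..Suc k. c i) * diameter X \<le> \<delta>"
    and D: "diameter X \<le> D" "0 < D" and \<delta>: "0 < \<delta>"
  shows "hausdorff_premeasure \<delta> s (attractor N \<phi> a 1) \<le> ennreal (D powr s * level_prod (Suc k))"
proof -
  define W where "W = PiE {1..Suc k} (\<lambda>i. {1..N i})"
  have W: "finite W" unfolding W_def by (intro finite_PiE) auto
  have in_W: "w i \<in> {1..N i}" if "w \<in> W" "i \<in> {1..Suc k}" for w i
    using that unfolding W_def by (auto simp: PiE_mem)
  let ?U = "\<lambda>w. comp_maps \<phi> w 1 k ` X"
  let ?t = "\<lambda>w. \<Prod>i=1..Suc k. r i (w i)"
  have t0: "0 < ?t w" if "w \<in> W" for w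
    using in_W[OF that] ratio_pos by (intro prod_pos) auto
  have cover: "attractor N \<phi> a 1 \<subseteq> (\<Union>w\<in>W. ?U w)"
  proof
    fix x assume "x \<in> attractor N \<phi> a 1"
    then obtain w where w: "address w" "(\<lambda>k. comp_maps \<phi> w 1 k a) \<longlonglongrightarrow> x"
      unfolding attractor_alt by blast
    \<comment> \<open>An address is cut off after \<open>Suc k\<close> levels; the cylinder depends
      on no later coordinate.\<close>
    have "restrict w {1..Suc k} \<in> W"
      using w(1) unfolding W_def address_def by (auto simp: restrict_def)
    moreover have "comp_maps \<phi> (restrict w {1..Suc k}) 1 k = comp_maps \<phi> w 1 k"
      by (rule comp_maps_cong) auto
    ultimately show "x \<in> (\<Union>w\<in>W. ?U w)"
      using limit_in_cylinder[OF w(1) a w(2), of k] by (metis UN_iff)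
  qed
  have U: "bounded (?U w) \<and> diameter (?U w) \<le> ?t w * diameter X" if "w \<in> W" for w
    using that in_W by (intro similarity_diameter_le comp_maps_similarity bounded_X) auto
  have "?t w \<le> (\<Prod>i=1..Suc k. c i)" if "w \<in> W" for w
    using in_W[OF that] ratio_pos ratio_le by (intro prod_mono) (auto intro: less_imp_le)
  then have "?t w * diameter X \<le> \<delta>" if "w \<in> W" for w
    using small that diameter_ge_0[OF bounded_X] by (meson mult_right_mono order_trans)
  then have "hausdorff_premeasure \<delta> s (attractor N \<phi> a 1) \<le> (\<Sum>w\<in>W. diam_powr s (?U w))"
    using U \<delta> by (intro hausdorff_premeasure_le_sum W cover) (auto intro: order_trans)
  also have "\<dots> \<le> (\<Sum>w\<in>W. ennreal ((?t w * D) powr s))"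
  proof (rule sum_mono)
    fix w assume w: "w \<in> W"
    have "?t w * diameter X \<le> ?t w * D"
      using t0[OF w] D by (intro mult_left_mono) auto
    then show "diam_powr s (?U w) \<le> ennreal ((?t w * D) powr s)"
      using U[OF w] t0[OF w] D s_nonneg by (intro diam_powr_le) auto
  qed
  also have "\<dots> = ennreal (\<Sum>w\<in>W. (?t w * D) powr s)"
    by (intro sum_ennreal) auto
  also have "(\<Sum>w\<in>W. (?t w * D) powr s) = (\<Sum>w\<in>W. D powr s * (\<Prod>i=1..Suc k. r i (w i) powr s))"
  proof (rule sum.cong)
    fix w assume w: "w \<in> W"
    have "?t w powr s = (\<Prod>i=1..Suc k. r i (w i) powr s)"
      by (rule prod_powr_distrib)
    then show "(?t w * D) powr s = D powr s * (\<Prod>i=1..Suc k. r i (w i) powr s)"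
      using t0[OF w] D by (simp add: powr_mult)
  qed simp
  \<comment> \<open>Expanding the product of the level sums gives one term for each choice of an
    index at every level.\<close>
  also have "\<dots> = D powr s * level_prod (Suc k)"
    unfolding level_sum_def W_def by (subst prod_sum_PiE) (auto simp: sum_distrib_left)
  finally show ?thesis .
qed

text \<open>For each \<open>\<delta>\<close> a single level with small product is enough, if it is
  deep enough for its cylinders to have diameter below \<open>\<delta>\<close>. This is why the
  lower limit governs the upper bound.\<close>

lemma hausdorff_measure_attractor_le:
  assumes a: "a \<in> X" and D: "diameter X \<le> D" "0 < D"
    and freq: "\<exists>\<^sub>F n in sequentially. level_prod n \<le> M"
  shows "hausdorff_measure s (attractor N \<phi> a 1) \<le> ennreal (D powr s * M)"
proof (rule hausdorff_measure_leI)
  fix \<delta> :: real assume \<delta>: "0 < \<delta>"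
  obtain K where K: "\<And>k. K \<le> k \<Longrightarrow> (\<Prod>i=1..Suc k. c i) * diameter X < \<delta>"
    using shrink[OF \<delta>] unfolding eventually_sequentially by blast
  obtain n where n: "Suc K \<le> n" "level_prod n \<le> M"
    using freq unfolding frequently_sequentially by blast
  define k where "k = n - 1"
  have k: "K \<le> k" "n = Suc k" using n(1) by (auto simp: k_def)
  have "hausdorff_premeasure \<delta> s (attractor N \<phi> a 1) \<le> ennreal (D powr s * level_prod (Suc k))"
    using K[OF k(1)] by (intro hausdorff_premeasure_attractor_le a D \<delta>) auto
  also have "\<dots> \<le> ennreal (D powr s * M)"
    using n(2) unfolding k(2) by (intro ennreal_leI mult_left_mono) auto
  finally show "hausdorff_premeasure \<delta> s (attractor N \<phi> a 1) \<le> ennreal (D powr s * M)" .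
qed

subsection \<open>Finite subcovers\<close>

text \<open>The tree of cylinders is explored from a node given by its level \<open>m\<close> and the composed map
  \<open>g\<close> leading to it; the cylinder at that node is \<open>g ` X\<close>, and its children are indexed by
  \<open>{1..N m}\<close>.\<close>

primrec refines :: "(nat \<Rightarrow> 'a set) \<Rightarrow> nat set \<Rightarrow> nat \<Rightarrow> nat \<Rightarrow> ('a \<Rightarrow> 'a) \<Rightarrow> bool" where
  "refines B I 0 m g \<longleftrightarrow> (\<exists>i\<in>I. g ` X \<subseteq> B i)"
| "refines B I (Suc k) m g \<longleftrightarrow> (\<forall>j\<in>{1..N m}. refines B I k (Suc m) (g \<circ> \<phi> m j))"

lemma child_image: "\<lbrakk>1 \<le> m; j \<in> {1..N m}\<rbrakk> \<Longrightarrow> (g \<circ> \<phi> m j) ` X \<subseteq> g ` X"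
  using map_X[of m j] by (auto simp: image_comp[symmetric])

text \<open>A child cylinder stays in whichever \<open>B i\<close> contains its parent.\<close>

lemma refines_Suc: "\<lbrakk>refines B I k m g; 1 \<le> m\<rbrakk> \<Longrightarrow> refines B I (Suc k) m g"
proof (induction k arbitrary: m g)
  case 0
  then obtain i where "i \<in> I" "g ` X \<subseteq> B i" by auto
  then show ?case
    unfolding refines.simps using child_image[OF 0(2)] by (meson order_trans)
next
  case (Suc k)
  have "refines B I (Suc k) (Suc m) (g \<circ> \<phi> m j)" if "j \<in> {1..N m}" for j
  proof (rule Suc.IH)
    show "refines B I k (Suc m) (g \<circ> \<phi> m j)"
      using Suc.prems(1) that unfolding refines.simps by blast
  qed simp
  then show ?case by (subst refines.simps) blast
qed

lemma refines_mono: "\<lbrakk>k \<le> l; refines B I k m g; 1 \<le> m\<rbrakk> \<Longrightarrow> refines B I l m g"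
  by (induction l rule: dec_induct) (auto intro: refines_Suc simp del: refines.simps)

lemma refines_index_mono: "\<lbrakk>refines B I k m g; I \<subseteq> J\<rbrakk> \<Longrightarrow> refines B J k m g"
  by (induction k arbitrary: m g) auto

text \<open>Only finitely many cylinders lie \<open>k\<close> levels below a node, and each needs
  one index.\<close>

lemma refines_finite:
  "refines B I k m g \<Longrightarrow> \<exists>F. finite F \<and> F \<subseteq> I \<and> refines B F k m g"
proof (induction k arbitrary: m g)
  case 0
  then obtain i where "i \<in> I" "g ` X \<subseteq> B i" by auto
  then show ?case by (intro exI[of _ "{i}"]) auto
next
  case (Suc k)
  have "\<forall>j\<in>{1..N m}. \<exists>F. finite F \<and> F \<subseteq> I \<and> refines B F k (Suc m) (g \<circ> \<phi> m j)"
  proof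
    fix j assume "j \<in> {1..N m}"
    with Suc.prems have "refines B I k (Suc m) (g \<circ> \<phi> m j)"
      unfolding refines.simps by (rule bspec)
    then show "\<exists>F. finite F \<and> F \<subseteq> I \<and> refines B F k (Suc m) (g \<circ> \<phi> m j)"
      by (rule Suc.IH)
  qed
  then obtain F where F: "\<And>j. j \<in> {1..N m} \<Longrightarrow> finite (F j) \<and> F j \<subseteq> I \<and> refines B (F j) k (Suc m) (g \<circ> \<phi> m j)"
    by metis
  show ?case
  proof (intro exI[of _ "\<Union>j\<in>{1..N m}. F j"] conjI)
    show "refines B (\<Union>j\<in>{1..N m}. F j) (Suc k) m g"
      unfolding refines.simps
    proof
      fix j assume j: "j \<in> {1..N m}"
      then have "refines B (F j) k (Suc m) (g \<circ> \<phi> m j)" using F by simp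
      then show "refines B (\<Union>j\<in>{1..N m}. F j) k (Suc m) (g \<circ> \<phi> m j)"
        by (rule refines_index_mono) (use j in blast)
    qed
    show "finite (\<Union>j\<in>{1..N m}. F j)" "(\<Union>j\<in>{1..N m}. F j) \<subseteq> I"
      using F by (auto, blast)
  qed
qed

lemma not_refines_child:
  assumes m: "1 \<le> m" and no: "\<And>k. \<not> refines B I k m g"
  shows "\<exists>j\<in>{1..N m}. \<forall>k. \<not> refines B I k (Suc m) (g \<circ> \<phi> m j)"
proof (rule ccontr)
  assume "\<not> ?thesis"
  then obtain h where h: "\<And>j. j \<in> {1..N m} \<Longrightarrow> refines B I (h j) (Suc m) (g \<circ> \<phi> m j)"
    by metis
  \<comment> \<open>As the branching is finite, the sum is a common depth dominating every
    \<open>h j\<close>.\<close>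
  define K where "K = (\<Sum>j=1..N m. h j)"
  have "refines B I K (Suc m) (g \<circ> \<phi> m j)" if "j \<in> {1..N m}" for j
    using h[OF that] that by (rule_tac refines_mono) (auto simp: K_def intro: member_le_sum)
  then have "refines B I (Suc K) m g" by simp
  with no show False by blast
qed

text \<open>Otherwise Koenig's lemma yields an infinite branch of cylinders contained in no \<open>B i\<close>,
  although they shrink to a point of the attractor.\<close>

lemma cover_refines:
  assumes a: "a \<in> X" and op: "\<And>i. i \<in> I \<Longrightarrow> open (B i)"
    and cover: "attractor N \<phi> a 1 \<subseteq> (\<Union>i\<in>I. B i)"
  obtains k where "refines B I k 1 id"
proof (rule ccontr)
  assume "\<not> thesis"
  then have no: "\<And>k. \<not> refines B I k 1 id" using that by blast
  \<comment> \<open>The chosen \<open>f n\<close> is the map leading to a node of level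
    \<open>Suc n\<close>; the clause for 0 anchors the branch at the root.\<close>
  have "\<exists>f. \<forall>n. ((n = 0 \<longrightarrow> f n = id) \<and> (\<forall>k. \<not> refines B I k (Suc n) (f n)))
      \<and> (\<exists>j\<in>{1..N (Suc n)}. f (Suc n) = f n \<circ> \<phi> (Suc n) j)"
  proof (rule dependent_nat_choice)
    show "\<exists>g. (0 = (0::nat) \<longrightarrow> g = id) \<and> (\<forall>k. \<not> refines B I k (Suc 0) g)"
      using no by simp
  next
    fix g n assume "(n = 0 \<longrightarrow> g = id) \<and> (\<forall>k. \<not> refines B I k (Suc n) g)"
    then obtain j where "j \<in> {1..N (Suc n)}" "\<And>k. \<not> refines B I k (Suc (Suc n)) (g \<circ> \<phi> (Suc n) j)"
      using not_refines_child[of "Suc n" B I g] by auto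
    then show "\<exists>h. ((Suc n = 0 \<longrightarrow> h = id) \<and> (\<forall>k. \<not> refines B I k (Suc (Suc n)) h))
        \<and> (\<exists>j\<in>{1..N (Suc n)}. h = g \<circ> \<phi> (Suc n) j)"
      by (intro exI[of _ "g \<circ> \<phi> (Suc n) j"]) blast
  qed
  then obtain f where f0: "f 0 = id" and f_no: "\<And>n k. \<not> refines B I k (Suc n) (f n)"
    and "\<And>n. \<exists>j\<in>{1..N (Suc n)}. f (Suc n) = f n \<circ> \<phi> (Suc n) j" by metis
  then obtain v where v: "\<And>n. v n \<in> {1..N (Suc n)} \<and> f (Suc n) = f n \<circ> \<phi> (Suc n) (v n)"
    by metis
  \<comment> \<open>Addresses start at level 1, while \<open>v n\<close> is the choice made at level
    \<open>Suc n\<close>.\<close>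
  define w where "w n = v (n - 1)" for n
  have w: "address w"
    unfolding address_def
  proof (intro allI impI)
    fix n :: nat assume "1 \<le> n"
    then show "w n \<in> {1..N n}" using v[of "n - 1"] by (simp add: w_def)
  qed
  have f_Suc: "f (Suc k) = comp_maps \<phi> w 1 k" for k
  proof (induction k)
    case 0
    then show ?case using v[of 0] f0 by (simp add: w_def)
  next
    case (Suc k)
    have "f (Suc (Suc k)) = f (Suc k) \<circ> \<phi> (Suc (Suc k)) (v (Suc k))"
      using v by blast
    then show ?case
      by (simp only: Suc.IH comp_maps.simps plus_1_eq_Suc w_def diff_Suc_1)
  qed
  obtain x where x: "(\<lambda>k. comp_maps \<phi> w 1 k a) \<longlonglongrightarrow> x"
    using address_converges[OF w a] .
  then have "x \<in> attractor N \<phi> a 1" using w attractor_alt by blast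
  then obtain i where i: "i \<in> I" "x \<in> B i" using cover by blast
  then obtain e where e: "0 < e" "ball x e \<subseteq> B i" using op openE by metis
  obtain K where K: "(\<Prod>i=1..Suc K. c i) * diameter X < e"
    using shrink[OF e(1)] eventually_happens' sequentially_bot by blast
  have "comp_maps \<phi> w 1 K ` X \<subseteq> ball x e"
  proof
    fix y assume y: "y \<in> comp_maps \<phi> w 1 K ` X"
    have "dist x y \<le> (\<Prod>i=1..Suc K. c i) * diameter X"
      using w y limit_in_cylinder[OF w a x]
      by (intro comp_maps_dist_le[of K w]) (auto simp: address_def)
    with K show "y \<in> ball x e" by simp
  qed
  \<comment> \<open>The cylinder now lies in one \<open>B i\<close>, so depth 0 already suffices at
    this node of the branch.\<close>
  then have "refines B I 0 (Suc (Suc K)) (f (Suc K))"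
    using e i unfolding refines.simps f_Suc by blast
  with f_no show False by blast
qed

end

text \<open>\<open>\<beta>\<close> bounds the volumes of the open sets below;
  \<open>r\<^sub>0\<close> keeps the ratio of a first cylinder of ratio at most
  \<open>\<rho>\<close> from falling far below \<open>\<rho>\<close>.\<close>

locale moran_open_set = moran_system +
  fixes V :: "nat \<Rightarrow> 'a set" and \<beta> r\<^sub>0 :: real
  assumes V_open: "1 \<le> n \<Longrightarrow> open (V n)"
    and V_subset: "1 \<le> n \<Longrightarrow> V n \<subseteq> X"
    and map_V: "\<lbrakk>1 \<le> n; j \<in> {1..N n}\<rbrakk> \<Longrightarrow> \<phi> n j ` V (Suc n) \<subseteq> V n"
    and V_disjoint: "\<lbrakk>1 \<le> n; i \<in> {1..N n}; j \<in> {1..N n}; i \<noteq> j\<rbrakk>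
        \<Longrightarrow> \<phi> n i ` V (Suc n) \<inter> \<phi> n j ` V (Suc n) = {}"
    and \<beta>_pos: "0 < \<beta>"
    and V_measure: "1 \<le> n \<Longrightarrow> \<beta> \<le> measure lborel (V n)"
    and r\<^sub>0_pos: "0 < r\<^sub>0"
    and r\<^sub>0_le_1: "r\<^sub>0 \<le> 1"
    and r\<^sub>0_le: "\<lbrakk>1 \<le> n; j \<in> {1..N n}\<rbrakk> \<Longrightarrow> r\<^sub>0 \<le> r n j"
begin

subsection \<open>The lower bound\<close>

text \<open>Nodes are encoded as for \<open>refines\<close>, with the ratio \<open>t\<close> of \<open>g\<close> carried along; only the
  cylinders \<open>k\<close> levels below the node that lie in \<open>U\<close> are counted.\<close>

primrec mass :: "'a set \<Rightarrow> nat \<Rightarrow> nat \<Rightarrow> ('a \<Rightarrow> 'a) \<Rightarrow> real \<Rightarrow> real" where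
  "mass U 0 m g t = (if g ` X \<subseteq> U then t powr s else 0)"
| "mass U (Suc k) m g t = (\<Sum>j=1..N m. mass U k (Suc m) (g \<circ> \<phi> m j) (t * r m j))"

lemma mass_nonneg: "0 \<le> mass U k m g t"
  by (induction k arbitrary: m g t) (auto intro!: sum_nonneg simp del: comp_apply)

text \<open>Mass conservation: the total weight \<open>Suc k\<close> levels below a node is the sum
  of the totals below its children.\<close>

lemma level_prod_split:
  assumes "1 \<le> m"
  shows "(t powr s) * (\<Prod>i=m..<m + Suc k. level_sum i)
      = (\<Sum>j=1..N m. (t powr s * r m j powr s) * (\<Prod>i=Suc m..<Suc m + k. level_sum i))"
proof -
  have "(\<Prod>i=m..<m + Suc k. level_sum i) = level_sum m * (\<Prod>i=Suc m..<Suc m + k. level_sum i)"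
    by (subst prod.atLeast_Suc_lessThan) auto
  then show ?thesis
    by (simp add: level_sum_def sum_distrib_left sum_distrib_right mult_ac)
qed

text \<open>The right side is the total weight of all cylinders \<open>k\<close> levels down,
  whether or not they lie in \<open>U\<close>.\<close>

lemma mass_le:
  assumes "0 \<le> t" "1 \<le> m"
  shows "mass U k m g t \<le> t powr s * (\<Prod>i=m..<m + k. level_sum i)"
  using assms
proof (induction k arbitrary: m g t)
  case (Suc k)
  have "mass U k (Suc m) (g \<circ> \<phi> m j) (t * r m j)
      \<le> (t powr s * r m j powr s) * (\<Prod>i=Suc m..<Suc m + k. level_sum i)" if "j \<in> {1..N m}" for j
  proof -
    have r: "0 < r m j" using ratio_pos[OF Suc.prems(2) that] .
    then have "mass U k (Suc m) (g \<circ> \<phi> m j) (t * r m j)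
        \<le> (t * r m j) powr s * (\<Prod>i=Suc m..<Suc m + k. level_sum i)"
      using Suc.prems by (intro Suc.IH) auto
    also have "(t * r m j) powr s = t powr s * r m j powr s"
      by (rule powr_mult)
    finally show ?thesis .
  qed
  then show ?case
    unfolding mass.simps level_prod_split[OF Suc.prems(2)] by (rule sum_mono)
qed simp

text \<open>Each cylinder \<open>k\<close> levels down lies in some \<open>B i\<close> with
  \<open>i \<in> F\<close>, so the sum counts its weight at least once.\<close>

lemma sum_mass_ge:
  assumes "refines B F k m g" "finite F" "0 \<le> t" "1 \<le> m"
  shows "t powr s * (\<Prod>i=m..<m + k. level_sum i) \<le> (\<Sum>i\<in>F. mass (B i) k m g t)"
  using assms
proof (induction k arbitrary: m g t)
  case 0
  then obtain i where i: "i \<in> F" "g ` X \<subseteq> B i" by auto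
  have "mass (B i) 0 m g t \<le> (\<Sum>i\<in>F. mass (B i) 0 m g t)"
    using i 0 by (intro member_le_sum mass_nonneg) auto
  then show ?case using i by simp
next
  case (Suc k)
  have "(t powr s * r m j powr s) * (\<Prod>i=Suc m..<Suc m + k. level_sum i)
      \<le> (\<Sum>i\<in>F. mass (B i) k (Suc m) (g \<circ> \<phi> m j) (t * r m j))" if j: "j \<in> {1..N m}" for j
  proof -
    have r: "0 < r m j" using ratio_pos[OF Suc.prems(4) j] .
    have "refines B F k (Suc m) (g \<circ> \<phi> m j)"
      using Suc.prems(1) j unfolding refines.simps by blast
    then have "(t * r m j) powr s * (\<Prod>i=Suc m..<Suc m + k. level_sum i)
        \<le> (\<Sum>i\<in>F. mass (B i) k (Suc m) (g \<circ> \<phi> m j) (t * r m j))"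
    proof (rule Suc.IH)
    qed (use Suc.prems(2-4) r in auto)
    also have "(t * r m j) powr s = t powr s * r m j powr s"
      by (rule powr_mult)
    finally show ?thesis .
  qed
  then have "t powr s * (\<Prod>i=m..<m + Suc k. level_sum i)
      \<le> (\<Sum>j=1..N m. \<Sum>i\<in>F. mass (B i) k (Suc m) (g \<circ> \<phi> m j) (t * r m j))"
    unfolding level_prod_split[OF Suc.prems(4)] by (rule sum_mono)
  also have "\<dots> = (\<Sum>i\<in>F. mass (B i) (Suc k) m g t)"
    unfolding mass.simps by (rule sum.swap)
  finally show ?case .
qed

lemma mass_eq_0:
  assumes "g ` X \<inter> U = {}" "1 \<le> m"
  shows "mass U k m g t = 0"
  using assms
proof (induction k arbitrary: m g t)
  case 0
  then show ?case using X_nonempty by auto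
next
  case (Suc k)
  have "mass U k (Suc m) (g \<circ> \<phi> m j) (t * r m j) = 0" if "j \<in> {1..N m}" for j
  proof (rule Suc.IH)
    show "(g \<circ> \<phi> m j) ` X \<inter> U = {}"
      using child_image[OF Suc.prems(2) that, of g] Suc.prems(1)
      by (metis disjoint_iff subsetD)
  qed simp
  then show ?case
    unfolding mass.simps by (intro sum.neutral) blast
qed

lemma measure_cylinder_ge:
  assumes g: "similarity t g" and n: "1 \<le> n"
  shows "t ^ DIM('a) * \<beta> \<le> measure lborel (g ` V n)"
proof -
  have "t ^ DIM('a) * \<beta> \<le> t ^ DIM('a) * measure lborel (V n)"
    using g V_measure[OF n] by (intro mult_left_mono) (auto simp: similarity_def)
  also have "\<dots> \<le> measure lborel (g ` V n)"
    using g V_open[OF n] bounded_subset[OF bounded_X V_subset[OF n]]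
    by (intro similarity_measure_open_ge)
  finally show ?thesis .
qed

text \<open>The children's open sets are disjoint and lie in the parent's, so volume bounds obtained
  for single cylinders add up on the way back to the root.\<close>

lemma sum_measure_children_le:
  assumes g: "similarity t g" and m: "1 \<le> m" and B: "closed B"
  shows "(\<Sum>j=1..N m. measure lborel ((g \<circ> \<phi> m j) ` V (Suc m) \<inter> B)) \<le> measure lborel (g ` V m \<inter> B)"
proof -
  let ?A = "\<lambda>j. (g \<circ> \<phi> m j) ` V (Suc m) \<inter> B"
  have fm: "h ` V n \<inter> B \<in> fmeasurable lborel" if h: "similarity u h" and n: "1 \<le> n" for u h n
  proof (rule fmeasurableI)
    show "h ` V n \<inter> B \<in> sets lborel"
      using similarity_image_open[OF h V_open[OF n]] B by auto
    have "bounded (h ` V n \<inter> B)"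
      using similarity_diameter_le[OF h bounded_subset[OF bounded_X V_subset[OF n]]]
      by (meson bounded_Int)
    then show "emeasure lborel (h ` V n \<inter> B) < \<infinity>"
      by (rule emeasure_bounded_finite)
  qed
  have fA: "?A j \<in> fmeasurable lborel" if "j \<in> {1..N m}" for j
    using similarity_comp[OF g similarity_map[OF m that]] by (rule fm) simp
  have "pairwise (\<lambda>i j. disjnt (?A i) (?A j)) {1..N m}"
  proof (rule pairwiseI)
    fix i j assume ij: "i \<in> {1..N m}" "j \<in> {1..N m}" "i \<noteq> j"
    have "g ` (\<phi> m i ` V (Suc m)) \<inter> g ` (\<phi> m j ` V (Suc m)) = {}"
      using V_disjoint[OF m ij] image_Int[OF similarity_inj[OF g], symmetric] by simp
    then show "disjnt (?A i) (?A j)"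
      unfolding disjnt_def image_comp by blast
  qed
  then have "(\<Sum>j=1..N m. measure lborel (?A j)) = measure lborel (\<Union>j\<in>{1..N m}. ?A j)"
    using fA by (intro measure_UNION'[symmetric]) auto
  also have "\<dots> \<le> measure lborel (g ` V m \<inter> B)"
  proof (rule measure_mono_fmeasurable)
    have "g ` \<phi> m j ` V (Suc m) \<subseteq> g ` V m" if "j \<in> {1..N m}" for j
      using map_V[OF m that] by (rule image_mono)
    then show "(\<Union>j\<in>{1..N m}. ?A j) \<subseteq> g ` V m \<inter> B"
      unfolding image_comp by blast
    show "(\<Union>j\<in>{1..N m}. ?A j) \<in> sets lborel"
      using fA by (intro sets.finite_UN fmeasurableD) simp_all
  qed (rule fm[OF g m])
  finally show ?thesis .
qed

text \<open>Descending the tree stops at the first cylinder whose ratio is at most \<open>\<rho>\<close>; if such a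
  cylinder meets \<open>ball y \<rho>\<close>, then it lies in a slightly larger ball and takes up a volume of at
  least \<open>(r\<^sub>0 * \<rho>) ^ DIM('a) * \<beta>\<close> there.\<close>

lemma mass_ball_le:
  assumes "1 \<le> m" "similarity t g" "\<rho> < t" "r\<^sub>0 ^ (m - 1) \<le> t"
    and "t * (\<Prod>i=m..<m + k. c i) \<le> \<rho>"
    and \<rho>: "0 < \<rho>" and L: "0 < L" "\<And>q. r\<^sub>0 ^ q \<le> \<rho> \<Longrightarrow> L \<le> (\<Prod>i=1..<Suc q. level_sum i)"
  shows "mass (ball y \<rho>) k m g t \<le> \<rho> powr s / (L * ((r\<^sub>0 * \<rho>) ^ DIM('a) * \<beta>))
     * (\<Prod>i=1..<m + k. level_sum i) * measure lborel (g ` V m \<inter> cball y (\<rho> * (1 + diameter X)))"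
  using assms(1-5)
proof (induction k arbitrary: m g t)
  case 0
  \<comment> \<open>At depth 0 the hypotheses give both \<open>\<rho> < t\<close> and
    \<open>t \<le> \<rho>\<close>: the descent must have stopped earlier.\<close>
  then show ?case by simp
next
  case (Suc k)
  let ?B = "cball y (\<rho> * (1 + diameter X))"
  let ?v = "(r\<^sub>0 * \<rho>) ^ DIM('a) * \<beta>"
  let ?A = "\<rho> powr s / (L * ?v)"
  let ?P = "\<Prod>i=1..<m + Suc k. level_sum i"
  have P: "0 < ?P" by (intro prod_pos level_sum_pos) auto
  have v: "0 < ?v" using \<rho> r\<^sub>0_pos \<beta>_pos by simp
  have t: "0 < t" using Suc.prems \<rho> by linarith
  have "mass (ball y \<rho>) k (Suc m) (g \<circ> \<phi> m j) (t * r m j)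
      \<le> ?A * ?P * measure lborel ((g \<circ> \<phi> m j) ` V (Suc m) \<inter> ?B)" if j: "j \<in> {1..N m}" for j
  proof -
    let ?g = "g \<circ> \<phi> m j" and ?t = "t * r m j"
    have g: "similarity ?t ?g"
      using Suc.prems(2) similarity_map[OF Suc.prems(1) j] by (rule similarity_comp)
    have rj: "0 < r m j" using ratio_pos[OF Suc.prems(1) j] .
    have "r\<^sub>0 ^ (m - 1) * r\<^sub>0 \<le> ?t"
      using Suc.prems r\<^sub>0_le[OF Suc.prems(1) j] r\<^sub>0_pos t by (intro mult_mono) auto
    then have r\<^sub>0m: "r\<^sub>0 ^ m \<le> ?t"
      using Suc.prems(1) by (metis power_minus_mult zero_less_one order_less_le_trans)
    \<comment> \<open>Either the descent continues, or it stops at this child, which misses or meets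
      the ball.\<close>
    consider "\<rho> < ?t" | "?t \<le> \<rho>" "?g ` X \<inter> ball y \<rho> = {}" | "?t \<le> \<rho>" "?g ` X \<inter> ball y \<rho> \<noteq> {}"
      by linarith
    then show ?thesis
    proof cases
      case 1
      \<comment> \<open>Since \<open>r m j \<le> c m\<close>, the remaining depth still suffices to
        bring the ratio down to \<open>\<rho>\<close>.\<close>
      have "?t * (\<Prod>i=Suc m..<Suc m + k. c i) \<le> t * (c m * (\<Prod>i=Suc m..<Suc m + k. c i))"
        unfolding mult.assoc using t ratio_le[OF Suc.prems(1) j]
        by (intro mult_left_mono mult_right_mono prod_nonneg) (auto intro: c_nonneg)
      also have "c m * (\<Prod>i=Suc m..<Suc m + k. c i) = (\<Prod>i=m..<m + Suc k. c i)"
        by (subst (2) prod.atLeast_Suc_lessThan) auto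
      also have "t * \<dots> \<le> \<rho>" by (rule Suc.prems(5))
      finally have "mass (ball y \<rho>) k (Suc m) ?g ?t
          \<le> ?A * (\<Prod>i=1..<Suc m + k. level_sum i) * measure lborel (?g ` V (Suc m) \<inter> ?B)"
        using g 1 r\<^sub>0m by (intro Suc.IH) (assumption | simp)+
      then show ?thesis by simp
    next
      case 2
      then have "mass (ball y \<rho>) k (Suc m) ?g ?t = 0" by (intro mass_eq_0) auto
      then show ?thesis using \<rho> L v P by simp
    next
      case 3
      have sub: "?g ` V (Suc m) \<inter> ?B = ?g ` V (Suc m)"
      proof -
        have gX: "bounded (?g ` X)" "diameter (?g ` X) \<le> \<rho> * diameter X"
          using similarity_diameter_le[OF g bounded_X] 3(1) diameter_ge_0[OF bounded_X]
          by (auto intro: order_trans mult_right_mono)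
        obtain z where z: "z \<in> ?g ` X" "dist y z < \<rho>"
          using 3(2) by (metis disjoint_iff mem_ball)
        have "x \<in> ?B" if "x \<in> ?g ` X" for x
        proof -
          have "dist y x \<le> dist y z + dist z x" by (rule dist_triangle)
          also have "\<dots> \<le> \<rho> + \<rho> * diameter X"
            using z(2) diameter_bounded_bound[OF gX(1) z(1) that] gX(2) by linarith
          finally show ?thesis by (simp add: algebra_simps)
        qed
        then show ?thesis using V_subset[of "Suc m"] by fastforce
      qed
      \<comment> \<open>The parent's ratio still exceeds \<open>\<rho>\<close>, and the last step
        shrinks by at least the factor \<open>r\<^sub>0\<close>.\<close>
      have "r\<^sub>0 * \<rho> \<le> ?t"
        using r\<^sub>0_le[OF Suc.prems(1) j] Suc.prems(3) r\<^sub>0_pos \<rho> rj t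
          mult_mono[of r\<^sub>0 "r m j" \<rho> t] by (simp add: mult.commute)
      then have "?v \<le> ?t ^ DIM('a) * \<beta>"
        using r\<^sub>0_pos \<rho> \<beta>_pos by (intro mult_right_mono power_mono) auto
      also have "\<dots> \<le> measure lborel (?g ` V (Suc m))"
        using g by (rule measure_cylinder_ge) simp
      finally have vol: "?v \<le> measure lborel (?g ` V (Suc m) \<inter> ?B)" by (simp only: sub)
      have "mass (ball y \<rho>) k (Suc m) ?g ?t \<le> ?t powr s * (\<Prod>i=Suc m..<Suc m + k. level_sum i)"
        using t rj by (intro mass_le) auto
      also have "\<dots> \<le> \<rho> powr s * (\<Prod>i=Suc m..<Suc m + k. level_sum i)"
        using 3(1) t rj s_nonneg
        by (intro mult_right_mono powr_mono2 prod_nonneg) (auto intro: less_imp_le level_sum_nonneg)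
      also have "\<dots> \<le> \<rho> powr s * (?P / L)"
      proof (rule mult_left_mono)
        \<comment> \<open>The child arises from \<open>m\<close> maps, so its ratio is at least
          \<open>r\<^sub>0 ^ m\<close>; stopping gives \<open>r\<^sub>0 ^ m \<le> \<rho>\<close>,
          and the bound \<open>L\<close> applies at level \<open>m\<close>.\<close>
        have "L \<le> (\<Prod>i=1..<Suc m. level_sum i)"
          using r\<^sub>0m 3(1) by (intro L) linarith
        then have "L * (\<Prod>i=Suc m..<Suc m + k. level_sum i)
            \<le> (\<Prod>i=1..<Suc m. level_sum i) * (\<Prod>i=Suc m..<Suc m + k. level_sum i)"
          by (intro mult_right_mono prod_nonneg) (auto intro: less_imp_le level_sum_nonneg)
        also have "\<dots> = ?P"
          by (subst prod.atLeastLessThan_concat) auto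
        finally show "(\<Prod>i=Suc m..<Suc m + k. level_sum i) \<le> ?P / L"
          using L(1) by (simp add: field_simps)
      qed simp
      \<comment> \<open>The factor \<open>?v\<close> is inserted and divided out, to be replaced
        next by the actual volume.\<close>
      also have "\<dots> = ?A * ?P * ?v"
      proof -
        have "x * (p / L) = x / (L * w) * p * w" if "0 < w" for x p w :: real
          using L(1) that by (simp add: field_simps)
        then show ?thesis using v by blast
      qed
      also have "\<dots> \<le> ?A * ?P * measure lborel (?g ` V (Suc m) \<inter> ?B)"
        using vol P L(1) v by (intro mult_left_mono) auto
      finally show ?thesis .
    qed
  qed
  then have "mass (ball y \<rho>) (Suc k) m g t
      \<le> (\<Sum>j=1..N m. ?A * ?P * measure lborel ((g \<circ> \<phi> m j) ` V (Suc m) \<inter> ?B))"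
    unfolding mass.simps by (rule sum_mono)
  also have "\<dots> = ?A * ?P * (\<Sum>j=1..N m. measure lborel ((g \<circ> \<phi> m j) ` V (Suc m) \<inter> ?B))"
    by (rule sum_distrib_left[symmetric])
  also have "\<dots> \<le> ?A * ?P * measure lborel (g ` V m \<inter> ?B)"
    using P L(1) v Suc.prems by (intro mult_left_mono sum_measure_children_le) auto
  finally show ?case .
qed

text \<open>The volume of a ball of radius \<open>\<rho> * (1 + diameter X)\<close> divided by the
  least volume \<open>(r\<^sub>0 * \<rho>) ^ DIM('a) * \<beta>\<close> of a stopped cylinder's open
  set; \<open>\<rho>\<close> cancels. It bounds the number of stopped cylinders meeting a ball of
  radius \<open>\<rho>\<close>.\<close>

definition covering_const :: real where
  "covering_const = unit_ball_vol (DIM('a)) * (1 + diameter X) ^ DIM('a) / (r\<^sub>0 ^ DIM('a) * \<beta>)"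

lemma covering_const_pos: "0 < covering_const"
  unfolding covering_const_def
  using r\<^sub>0_pos \<beta>_pos diameter_ge_0[OF bounded_X] unit_ball_vol_pos[of "DIM('a)"]
  by (intro divide_pos_pos mult_pos_pos zero_less_power) auto

text \<open>Finitely many balls carry the total weight \<open>level_prod n\<close> of some deep
  level \<open>n\<close>, and each carries at most a multiple of
  \<open>\<rho> i powr s * level_prod n / L\<close>; the level product cancels.\<close>

lemma ball_cover_sum_ge:
  fixes y :: "nat \<Rightarrow> 'a"
  assumes a: "a \<in> X" and \<rho>: "\<And>i. i \<in> I \<Longrightarrow> 0 < \<rho> i \<and> \<rho> i < 1"
    and cover: "attractor N \<phi> a 1 \<subseteq> (\<Union>i\<in>I. ball (y i) (\<rho> i))"
    and L: "0 < L" "\<And>i q. \<lbrakk>i \<in> I; r\<^sub>0 ^ q \<le> \<rho> i\<rbrakk> \<Longrightarrow> L \<le> level_prod q"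
  obtains F where "finite F" "F \<subseteq> I" "L \<le> covering_const * (\<Sum>i\<in>F. \<rho> i powr s)"
proof -
  let ?B = "\<lambda>i. ball (y i) (\<rho> i)"
  obtain k where k: "refines ?B I k 1 id"
    using cover_refines[OF a _ cover] by blast
  obtain F where F: "finite F" "F \<subseteq> I" "refines ?B F k 1 id"
    using refines_finite[OF k] by (elim exE conjE)
  \<comment> \<open>As \<open>F\<close> is finite, one depth lets the descent from the root stop for
    all its balls; \<open>\<rho> i < 1\<close> ensures that it has not stopped at the root.\<close>
  have "\<forall>\<^sub>F n in sequentially. \<forall>i\<in>F. (\<Prod>j=1..n. c j) < \<rho> i"
    using F \<rho> by (intro eventually_ball_finite ballI order_tendstoD(2)[OF c_prod_tendsto]) auto
  moreover have "\<forall>\<^sub>F n in sequentially. k \<le> n"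
    by (rule eventually_ge_at_top)
  ultimately have "\<forall>\<^sub>F n in sequentially. k \<le> n \<and> (\<forall>i\<in>F. (\<Prod>j=1..n. c j) < \<rho> i)"
    by eventually_elim auto
  then obtain n where n: "k \<le> n" "\<And>i. i \<in> F \<Longrightarrow> (\<Prod>j=1..n. c j) < \<rho> i"
    using eventually_happens' sequentially_bot by blast
  have "refines ?B F n 1 id"
    using refines_mono[OF n(1) F(3)] by simp
  then have "1 powr s * (\<Prod>i=1..<1 + n. level_sum i) \<le> (\<Sum>i\<in>F. mass (?B i) n 1 id 1)"
    using F(1) by (intro sum_mass_ge) auto
  then have "level_prod n \<le> (\<Sum>i\<in>F. mass (?B i) n 1 id 1)"
    by (simp add: atLeastLessThanSuc_atLeastAtMost)
  also have "\<dots> \<le> (\<Sum>i\<in>F. covering_const * \<rho> i powr s / L * level_prod n)"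
  proof (rule sum_mono)
    fix i assume i: "i \<in> F"
    have \<rho>i: "0 < \<rho> i" "\<rho> i < 1" using \<rho> F(2) i by auto
    let ?D = "1 + diameter X"
    have D: "0 \<le> ?D" using diameter_ge_0[OF bounded_X] by simp
    have "mass (?B i) n 1 id 1 \<le> \<rho> i powr s / (L * ((r\<^sub>0 * \<rho> i) ^ DIM('a) * \<beta>))
       * (\<Prod>i=1..<1 + n. level_sum i) * measure lborel (id ` V 1 \<inter> cball (y i) (\<rho> i * ?D))"
      using \<rho>i n(2)[OF i] F(2) i L
      by (intro mass_ball_le) (auto simp: similarity_id atLeastLessThanSuc_atLeastAtMost)
    also have "\<dots> \<le> \<rho> i powr s / (L * ((r\<^sub>0 * \<rho> i) ^ DIM('a) * \<beta>))
       * (\<Prod>i=1..<1 + n. level_sum i) * measure lborel (cball (y i) (\<rho> i * ?D))"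
      using \<rho>i L(1) r\<^sub>0_pos \<beta>_pos V_open[of 1]
      by (intro mult_left_mono measure_mono_fmeasurable mult_nonneg_nonneg prod_nonneg
          fmeasurable_compact compact_cball) (auto intro: level_sum_nonneg)
    also have "measure lborel (cball (y i) (\<rho> i * ?D))
        = unit_ball_vol (DIM('a)) * (\<rho> i ^ DIM('a) * ?D ^ DIM('a))"
      using D \<rho>i by (subst content_cball) (auto simp: power_mult_distrib)
    also have "\<rho> i powr s / (L * ((r\<^sub>0 * \<rho> i) ^ DIM('a) * \<beta>)) * (\<Prod>i=1..<1 + n. level_sum i)
        * (unit_ball_vol (DIM('a)) * (\<rho> i ^ DIM('a) * ?D ^ DIM('a)))
        = covering_const * \<rho> i powr s / L * level_prod n"
      using \<rho>i L(1) r\<^sub>0_pos \<beta>_pos unfolding covering_const_def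
      by (simp add: power_mult_distrib atLeastLessThanSuc_atLeastAtMost mult_ac)
    finally show "mass (?B i) n 1 id 1 \<le> covering_const * \<rho> i powr s / L * level_prod n" .
  qed
  also have "\<dots> = covering_const * (\<Sum>i\<in>F. \<rho> i powr s) / L * level_prod n"
    by (simp add: sum_distrib_left sum_distrib_right sum_divide_distrib)
  finally have "L \<le> covering_const * (\<Sum>i\<in>F. \<rho> i powr s)"
    using level_prod_pos[of n] L(1) by (simp add: field_simps)
  with F(1,2) that show thesis by blast
qed

lemma hausdorff_measure_attractor_ge:
  assumes a: "a \<in> X" and L: "0 < L" and ev: "\<forall>\<^sub>F n in sequentially. L \<le> level_prod n"
  shows "ennreal (L / covering_const) \<le> hausdorff_measure s (attractor N \<phi> a 1)"
proof -
  obtain q\<^sub>0 where q\<^sub>0: "\<And>q. q\<^sub>0 \<le> q \<Longrightarrow> L \<le> level_prod q"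
    using ev unfolding eventually_sequentially by blast
  \<comment> \<open>Enlarged radii stay below \<open>2 * \<delta> = r\<^sub>0 ^ q\<^sub>0\<close>,
    so \<open>r\<^sub>0 ^ q \<le> \<rho> i\<close> forces \<open>q\<close> beyond
    \<open>q\<^sub>0\<close>, where the level products are at least \<open>L\<close>.\<close>
  define \<delta> where "\<delta> = r\<^sub>0 ^ q\<^sub>0 / 2"
  have \<delta>: "0 < \<delta>" "2 * \<delta> \<le> 1"
    using r\<^sub>0_pos r\<^sub>0_le_1 by (auto simp: \<delta>_def power_le_one)
  have "ennreal (L / covering_const) \<le> hausdorff_premeasure \<delta> s (attractor N \<phi> a 1)"
    unfolding hausdorff_premeasure_def
  proof (rule INF_greatest, rule ennreal_le_epsilon)
    fix U :: "nat \<Rightarrow> 'a set" and e :: real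
    assume "U \<in> {U. attractor N \<phi> a 1 \<subseteq> (\<Union>i. U i) \<and> (\<forall>i. bounded (U i) \<and> diameter (U i) \<le> \<delta>)}"
      and e: "0 < e"
    then have cov: "attractor N \<phi> a 1 \<subseteq> (\<Union>i. U i)"
      and U: "\<And>i. bounded (U i)" "\<And>i. diameter (U i) \<le> \<delta>" by auto
    \<comment> \<open>Empty sets have no point to serve as a centre and are dropped.\<close>
    define I where "I = {i. U i \<noteq> {}}"
    \<comment> \<open>Geometric errors, with sum \<open>e\<close> over the whole cover.\<close>
    let ?e = "\<lambda>i. e * (1 / 2) ^ Suc i"
    have "\<exists>\<rho>. diameter (U i) < \<rho> \<and> \<rho> < 2 * \<delta> \<and> ennreal (\<rho> powr s) \<le> diam_powr s (U i) + ennreal (?e i)"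
      if "i \<in> I" for i
      using that U \<delta> e s_nonneg by (intro diam_powr_enlarge) (auto simp: I_def)
    then obtain \<rho> where \<rho>: "\<And>i. i \<in> I \<Longrightarrow> diameter (U i) < \<rho> i"
      "\<And>i. i \<in> I \<Longrightarrow> \<rho> i < 2 * \<delta>"
      "\<And>i. i \<in> I \<Longrightarrow> ennreal (\<rho> i powr s) \<le> diam_powr s (U i) + ennreal (?e i)"
      by metis
    define y where "y i = (SOME y. y \<in> U i)" for i
    have y: "y i \<in> U i" if "i \<in> I" for i
      using that some_in_eq unfolding y_def I_def by blast
    have "U i \<subseteq> ball (y i) (\<rho> i)" if "i \<in> I" for i
      using \<rho>(1)[OF that] diameter_bounded_bound[OF U(1) y[OF that]] by fastforce
    then have cover: "attractor N \<phi> a 1 \<subseteq> (\<Union>i\<in>I. ball (y i) (\<rho> i))"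
      using cov unfolding I_def by blast
    have \<rho>01: "0 < \<rho> i \<and> \<rho> i < 1" if "i \<in> I" for i
      using \<rho>(1,2)[OF that] diameter_ge_0[OF U(1)[of i]] \<delta> by linarith
    have "L \<le> level_prod q" if i: "i \<in> I" and q: "r\<^sub>0 ^ q \<le> \<rho> i" for i q
    proof (rule q\<^sub>0, rule ccontr)
      assume "\<not> q\<^sub>0 \<le> q"
      then have "r\<^sub>0 ^ q\<^sub>0 \<le> r\<^sub>0 ^ q"
        using r\<^sub>0_pos r\<^sub>0_le_1 by (intro power_decreasing) auto
      with q \<rho>(2)[OF i] show False by (simp add: \<delta>_def)
    qed
    then obtain F where F: "finite F" "F \<subseteq> I" "L \<le> covering_const * (\<Sum>i\<in>F. \<rho> i powr s)"
      using ball_cover_sum_ge[OF a \<rho>01 cover L] by blast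
    have "L / covering_const \<le> (\<Sum>i\<in>F. \<rho> i powr s)"
      using F(3) covering_const_pos by (simp add: field_simps)
    then have "ennreal (L / covering_const) \<le> ennreal (\<Sum>i\<in>F. \<rho> i powr s)"
      by (rule ennreal_leI)
    also have "\<dots> = (\<Sum>i\<in>F. ennreal (\<rho> i powr s))"
      by (rule sum_ennreal[symmetric]) simp
    also have "\<dots> \<le> (\<Sum>i\<in>F. diam_powr s (U i) + ennreal (?e i))"
      using \<rho>(3) F(2) by (intro sum_mono) auto
    also have "\<dots> \<le> (\<Sum>i. diam_powr s (U i) + ennreal (?e i))"
      by (rule sum_le_suminf) (auto simp: F(1))
    also have "\<dots> = (\<Sum>i. diam_powr s (U i)) + (\<Sum>i. ennreal (?e i))"
      by (rule suminf_add[symmetric]) auto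
    also have "(\<Sum>i. ennreal (?e i)) = ennreal e"
      using e sums_mult[OF power_half_series, of e] by (intro suminf_ennreal_eq) auto
    finally show "ennreal (L / covering_const) \<le> (\<Sum>i. diam_powr s (U i)) + ennreal e" .
  qed
  also have "\<dots> \<le> hausdorff_measure s (attractor N \<phi> a 1)"
    using \<delta>(1) by (rule hausdorff_premeasure_le_measure)
  finally show ?thesis .
qed

section \<open>Consequences of the value of the lower limit\<close>

lemma frequently_level_prod_le:
  assumes "liminf (\<lambda>n. ereal (level_prod n)) < ereal M"
  shows "\<exists>\<^sub>F n in sequentially. level_prod n \<le> M"
proof (rule ccontr)
  assume "\<not> ?thesis"
  then have "\<forall>\<^sub>F n in sequentially. ereal M \<le> ereal (level_prod n)"
    unfolding not_frequently by (rule eventually_mono) simp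
  then have "ereal M \<le> liminf (\<lambda>n. ereal (level_prod n))"
    by (rule Liminf_bounded)
  with assms show False by simp
qed

lemma eventually_le_level_prod:
  assumes "ereal L < liminf (\<lambda>n. ereal (level_prod n))"
  shows "\<forall>\<^sub>F n in sequentially. L \<le> level_prod n"
  using less_LiminfD[OF assms] by (rule eventually_mono) simp

lemma hausdorff_measure_attractor_pos:
  assumes a: "a \<in> X" and "0 < liminf (\<lambda>n. ereal (level_prod n))"
  shows "0 < hausdorff_measure s (attractor N \<phi> a 1)"
proof -
  obtain L where L: "0 < L" "ereal L < liminf (\<lambda>n. ereal (level_prod n))"
    using ereal_dense2[OF assms(2)] by (auto simp: zero_ereal_def)
  have "0 < ennreal (L / covering_const)"
    using L(1) covering_const_pos by simp
  also have "\<dots> \<le> hausdorff_measure s (attractor N \<phi> a 1)"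
    by (rule hausdorff_measure_attractor_ge[OF a L(1) eventually_le_level_prod[OF L(2)]])
  finally show ?thesis .
qed

lemma hausdorff_measure_attractor_infinite:
  assumes a: "a \<in> X" and "liminf (\<lambda>n. ereal (level_prod n)) = \<infinity>"
  shows "hausdorff_measure s (attractor N \<phi> a 1) = \<infinity>"
proof (rule ccontr)
  assume "hausdorff_measure s (attractor N \<phi> a 1) \<noteq> \<infinity>"
  then obtain h where h: "hausdorff_measure s (attractor N \<phi> a 1) = ennreal h" "0 \<le> h"
    by (cases "hausdorff_measure s (attractor N \<phi> a 1)") auto
  \<comment> \<open>Chosen so that the lower bound \<open>L / covering_const\<close> is
    \<open>h + 1\<close>, above the supposed finite value.\<close>
  define L where "L = covering_const * (h + 1)"
  have L: "0 < L" "L / covering_const = h + 1"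
    using covering_const_pos h(2) by (auto simp: L_def)
  have "ennreal (L / covering_const) \<le> ennreal h"
    unfolding h(1)[symmetric] using assms(2)
    by (intro hausdorff_measure_attractor_ge a L eventually_le_level_prod) auto
  then show False
    using h(2) by (simp add: L(2) ennreal_le_iff)
qed

lemma hausdorff_measure_attractor_finite:
  assumes a: "a \<in> X" and "liminf (\<lambda>n. ereal (level_prod n)) < \<infinity>"
  shows "hausdorff_measure s (attractor N \<phi> a 1) < \<infinity>"
proof -
  obtain M where M: "liminf (\<lambda>n. ereal (level_prod n)) < ereal M"
    using ereal_dense2[OF assms(2)] by auto
  have "hausdorff_measure s (attractor N \<phi> a 1) \<le> ennreal ((diameter X + 1) powr s * M)"
    using diameter_ge_0[OF bounded_X]
    by (intro hausdorff_measure_attractor_le a frequently_level_prod_le M) auto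
  also have "\<dots> < \<infinity>" by simp
  finally show ?thesis .
qed

lemma hausdorff_measure_attractor_zero:
  assumes a: "a \<in> X" and "liminf (\<lambda>n. ereal (level_prod n)) = 0"
  shows "hausdorff_measure s (attractor N \<phi> a 1) = 0"
proof -
  define D where "D = diameter X + 1"
  have D: "diameter X \<le> D" "0 < D"
    using diameter_ge_0[OF bounded_X] by (auto simp: D_def)
  have "hausdorff_measure s (attractor N \<phi> a 1) \<le> 0"
  proof (rule ennreal_le_epsilon)
    fix e :: real assume e: "0 < e"
    \<comment> \<open>The level products are frequently at most \<open>e / D powr s\<close>, which
      turns the upper bound into \<open>e\<close>.\<close>
    have "hausdorff_measure s (attractor N \<phi> a 1) \<le> ennreal (D powr s * (e / D powr s))"
      using assms(2) D e
      by (intro hausdorff_measure_attractor_le a D frequently_level_prod_le) auto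
    then show "hausdorff_measure s (attractor N \<phi> a 1) \<le> 0 + ennreal e"
      using D by simp
  qed
  then show ?thesis by simp
qed

end

section \<open>Self-similar systems\<close>

lemma similarity_sim_maps:
  assumes r: "0 < r n j" and Q: "orthogonal_matrix (Q n j)"
  shows "similarity (r n j) (sim_maps r Q \<alpha> n j)"
  unfolding similarity_def
proof (intro conjI allI)
  have ot: "orthogonal_transformation ((*v) (Q n j))"
    using Q by (simp add: orthogonal_transformation_matrix)
  show "0 < r n j" by (rule r)
  show "dist (sim_maps r Q \<alpha> n j x) (sim_maps r Q \<alpha> n j y) = r n j * dist x y" for x y
  proof -
    have "sim_maps r Q \<alpha> n j x - sim_maps r Q \<alpha> n j y = r n j *\<^sub>R (Q n j *v (x - y))"
      unfolding sim_maps_def scaleR_diff_right[symmetric] matrix_vector_mult_diff_distrib[symmetric]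
      by simp
    then show ?thesis
      using r orthogonal_transformation_norm[OF ot] by (simp add: dist_norm)
  qed
  show "surj (sim_maps r Q \<alpha> n j)"
    unfolding surj_def
  proof
    fix y
    \<comment> \<open>Undo the scaling, then the orthogonal map, and finally the inner
      translation.\<close>
    obtain x where "y /\<^sub>R r n j = Q n j *v x"
      using orthogonal_transformation_surj[OF ot] unfolding surj_def by blast
    then have "r n j *\<^sub>R (y /\<^sub>R r n j) = sim_maps r Q \<alpha> n j (x - \<alpha> n j)"
      by (simp add: sim_maps_def)
    then show "\<exists>x. y = sim_maps r Q \<alpha> n j x"
      using r by auto
  qed
qed

text \<open>The two infima in the hypotheses serve as the uniform bounds \<open>\<beta>\<close> and
  \<open>r\<^sub>0\<close> of the locale.\<close>

lemma moran_open_set_sim_maps: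
  assumes mifs: "self_similar_MIFS X N r Q \<alpha>"
    and mosc: "MOSC X N (sim_maps r Q \<alpha>)"
    and r\<^sub>0: "0 < Inf {r n j | n j. 1 \<le> n \<and> 1 \<le> j \<and> j \<le> N n}"
    and s: "0 \<le> s"
  obtains c V \<beta> r\<^sub>0 where "moran_open_set X N (sim_maps r Q \<alpha>) r c s V \<beta> r\<^sub>0"
proof -
  have X: "X \<noteq> {}" "compact X" and N: "\<And>n. 1 \<le> n \<Longrightarrow> 2 \<le> N n"
    and maps: "\<And>n j. \<lbrakk>1 \<le> n; j \<in> {1..N n}\<rbrakk> \<Longrightarrow> 0 < r n j \<and> r n j < 1 \<and>
       orthogonal_matrix (Q n j) \<and> sim_maps r Q \<alpha> n j ` X \<subseteq> X"
    using mifs unfolding self_similar_MIFS_def by blast+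
  obtain c where c: "\<And>n j. \<lbrakk>1 \<le> n; j \<in> {1..N n}\<rbrakk> \<Longrightarrow> r n j \<le> c n"
    and c_lim: "(\<lambda>n. \<Prod>j=1..n. c j) \<longlonglongrightarrow> 0"
    using mifs unfolding self_similar_MIFS_def by blast
  obtain V where V_open: "\<forall>n\<ge>1. open (V n) \<and> V n \<subseteq> X"
    and V_map: "\<forall>n\<ge>1. \<forall>j\<in>{1..N n}. sim_maps r Q \<alpha> n j ` V (Suc n) \<subseteq> V n"
    and V_disjoint: "\<forall>n\<ge>1. \<forall>i\<in>{1..N n}. \<forall>j\<in>{1..N n}. i \<noteq> j \<longrightarrow>
        sim_maps r Q \<alpha> n i ` V (Suc n) \<inter> sim_maps r Q \<alpha> n j ` V (Suc n) = {}"
    and V_pos: "0 < (INF n\<in>{1..}. emeasure lebesgue (V n))"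
    using mosc unfolding MOSC_def by (elim exE conjE) (rule that)
  note V = V_open[rule_format] V_map[rule_format] V_disjoint[rule_format]
  let ?m = "INF n\<in>{1..}. emeasure lebesgue (V n)"
  let ?R = "{r n j | n j. 1 \<le> n \<and> 1 \<le> j \<and> j \<le> N n}"
  have fin: "emeasure lborel (V n) < \<infinity>" if "1 \<le> n" for n
    using V(1)[OF that] X(2) by (meson bounded_subset compact_imp_bounded emeasure_bounded_finite)
  have m_le: "?m \<le> emeasure lborel (V n)" if "1 \<le> n" for n
  proof -
    have "?m \<le> emeasure lebesgue (V n)"
      using that by (intro INF_lower) auto
    then show ?thesis using V(1)[OF that] by (simp add: borel_open)
  qed
  \<comment> \<open>A real \<open>Inf\<close> is a lower bound only if the set is bounded below;
    here 0 works.\<close>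
  have bdd: "bdd_below ?R"
    using maps by (intro bdd_belowI[of _ 0]) (auto intro: less_imp_le)
  have r\<^sub>0_le: "Inf ?R \<le> r n j" if "1 \<le> n" "j \<in> {1..N n}" for n j
    using that by (intro cInf_lower bdd) auto
  show thesis
  proof (rule that, unfold_locales)
    \<comment> \<open>\<open>enn2real\<close> sends infinity to 0, so the infimum must be finite;
      this follows from the bounded set \<open>V 1\<close>.\<close>
    show "0 < enn2real ?m"
      using V_pos m_le[of 1] fin[of 1] by (simp add: enn2real_positive_iff order_le_less_trans)
    show "enn2real ?m \<le> measure lborel (V n)" if "1 \<le> n" for n
      unfolding measure_def using m_le[OF that] fin[OF that] by (intro enn2real_mono) auto
    show "Inf ?R \<le> 1"
      using r\<^sub>0_le[of 1 1] maps[of 1 1] N[of 1] by force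
    show "similarity (r n j) (sim_maps r Q \<alpha> n j)" if "1 \<le> n" "j \<in> {1..N n}" for n j
      using maps[OF that] by (intro similarity_sim_maps) auto
    show "1 \<le> N n" if "1 \<le> n" for n
      using N[OF that] by simp
    show "open (V n)" "V n \<subseteq> X" if "1 \<le> n" for n
      using V(1)[OF that] by simp_all
    show "sim_maps r Q \<alpha> n j ` X \<subseteq> X" if "1 \<le> n" "j \<in> {1..N n}" for n j
      using maps[OF that] by simp
  qed (rule X c c_lim s V(2,3) r\<^sub>0 r\<^sub>0_le; assumption)+
qed

theorem theorem4p2:
  fixes X :: "(real^'d) set"
    and N :: "nat \<Rightarrow> nat"
    and r :: "nat \<Rightarrow> nat \<Rightarrow> real"
    and Q :: "nat \<Rightarrow> nat \<Rightarrow> real^'d^'d"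
    and \<alpha> :: "nat \<Rightarrow> nat \<Rightarrow> real^'d"
    and a :: "real^'d"
    and s :: real
  assumes "self_similar_MIFS X N r Q \<alpha>"
    and "MOSC X N (sim_maps r Q \<alpha>)"
    and "0 < Inf {r n j | n j. 1 \<le> n \<and> 1 \<le> j \<and> j \<le> N n}"
    and "a \<in> X"
    and "0 \<le> s"
  shows
    "(0 < liminf (\<lambda>n. ereal (\<Prod>i=1..n. \<Sum>j=1..N i. r i j powr s)) \<and>
        liminf (\<lambda>n. ereal (\<Prod>i=1..n. \<Sum>j=1..N i. r i j powr s)) < \<infinity> \<longrightarrow>
        0 < hausdorff_measure s (attractor N (sim_maps r Q \<alpha>) a 1) \<and>
        hausdorff_measure s (attractor N (sim_maps r Q \<alpha>) a 1) < \<infinity> \<and>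
        hausdorff_dim (attractor N (sim_maps r Q \<alpha>) a 1) = ennreal s) \<and>
     (liminf (\<lambda>n. ereal (\<Prod>i=1..n. \<Sum>j=1..N i. r i j powr s)) = \<infinity> \<longrightarrow>
        hausdorff_measure s (attractor N (sim_maps r Q \<alpha>) a 1) = \<infinity> \<and>
        hausdorff_dim (attractor N (sim_maps r Q \<alpha>) a 1) \<ge> ennreal s) \<and>
     (liminf (\<lambda>n. ereal (\<Prod>i=1..n. \<Sum>j=1..N i. r i j powr s)) = 0 \<longrightarrow>
        hausdorff_measure s (attractor N (sim_maps r Q \<alpha>) a 1) = 0 \<and>
        hausdorff_dim (attractor N (sim_maps r Q \<alpha>) a 1) \<le> ennreal s)"
proof -
  obtain c V \<beta> r\<^sub>0 where "moran_open_set X N (sim_maps r Q \<alpha>) r c s V \<beta> r\<^sub>0"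
    using moran_open_set_sim_maps[OF assms(1-3,5)] .
  then interpret moran_open_set X N "sim_maps r Q \<alpha>" r c s V \<beta> r\<^sub>0 .
  let ?K = "attractor N (sim_maps r Q \<alpha>) a 1"
  let ?l = "liminf (\<lambda>n. ereal (level_prod n))"
  \<comment> \<open>Finite measure bounds the dimension above and nonzero measure bounds it below;
    the first case uses both.\<close>
  note dim = hausdorff_dim_le[of s ?K, OF _ \<open>0 \<le> s\<close>] hausdorff_dim_ge[of s ?K]
  have "0 < hausdorff_measure s ?K \<and> hausdorff_measure s ?K < \<infinity> \<and> hausdorff_dim ?K = ennreal s"
    if "0 < ?l" "?l < \<infinity>"
    using hausdorff_measure_attractor_pos[OF \<open>a \<in> X\<close> that(1)]
      hausdorff_measure_attractor_finite[OF \<open>a \<in> X\<close> that(2)] dim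
    by (simp add: antisym less_imp_neq)
  moreover have "hausdorff_measure s ?K = \<infinity> \<and> ennreal s \<le> hausdorff_dim ?K" if "?l = \<infinity>"
    using hausdorff_measure_attractor_infinite[OF \<open>a \<in> X\<close> that] dim by simp
  moreover have "hausdorff_measure s ?K = 0 \<and> hausdorff_dim ?K \<le> ennreal s" if "?l = 0"
    using hausdorff_measure_attractor_zero[OF \<open>a \<in> X\<close> that] dim by simp
  ultimately show ?thesis
    unfolding level_sum_def by blast
qed

end
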